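(* Let $X$ be a Banach space of trivial type. Then, for every $0<\varepsilon<\frac12$ and every $M\in\mathbb N$, $$\operatorname{WeakNet}_X(\varepsilon,M)\ge\tfrac12.$$ Consequently, there is no dimension-free weak $\varepsilon$-net theorem in $X$ whose approximation radius tends to zero: for $0<\varepsilon<\frac12$ and $0<\eta<\frac12$ there is no integer $M$ with $\operatorname{WeakNet}_X(\varepsilon,M)\le\eta$.
   Context: A Banach space $X$ has Rademacher type $p\in[1,2]$ if there is a constant $T<\infty$ such that for every finite sequence $x_1,\dots,x_m\in X$, $\left(\mathbb E\|\sum_i\epsilon_i x_i\|^p\right)^{1/p}\le T\left(\sum_i\|x_i\|^p\right)^{1/p}$, where $\epsilon_i$ are independent uniform $\pm1$ random variables. $X$ has trivial type if $\sup\{p\in[1,2]: X\text{ has type }p\}=1$. $$\operatorname{WeakNet}_X(\varepsilon,M)=\sup_P\ \inf_{F\subset X,\,|F|\le M}\ \sup_{Y\subset P,\,|Y|\ge\varepsilon|P|}\frac{\operatorname{dist}(F,\operatorname{conv}Y)}{\operatorname{diam}P},$$ where $P$ ranges over finite subsets of $X$ of positive diameter and $\operatorname{dist}(A,B)=\inf\{\|a-b\|:a\in A,b\in B\}$. *)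

theory Defs
  imports "HOL-Probability.Probability"
begin

text \<open>
  The joint law of \<open>m\<close> independent uniform signs, indexed by \<open>{..<m}\<close>;
  the value \<open>0\<close> is only the default outside the index set.
\<close>

definition rademacher_pmf :: "nat \<Rightarrow> (nat \<Rightarrow> real) pmf" where
  "rademacher_pmf m = Pi_pmf {..<m} 0 (\<lambda>_. pmf_of_set {-1, 1})"

definition has_rademacher_type :: "'a::real_normed_vector itself \<Rightarrow> real \<Rightarrow> bool" where
  "has_rademacher_type _ p \<longleftrightarrow>
     (\<exists>T::real. \<forall>(m::nat) (x :: nat \<Rightarrow> 'a).
        (measure_pmf.expectation (rademacher_pmf m)
           (\<lambda>\<epsilon>. norm (\<Sum>i<m. \<epsilon> i *\<^sub>R x i) powr p)) powr (1 / p)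
        \<le> T * (\<Sum>i<m. norm (x i) powr p) powr (1 / p))"

definition trivial_type :: "'a::real_normed_vector itself \<Rightarrow> bool" where
  "trivial_type X \<longleftrightarrow> Sup {p \<in> {1..2}. has_rademacher_type X p} = 1"

text \<open>
  Unlike the library's \<^const>\<open>setdist\<close>, which is \<open>0\<close> when one of the sets is empty,
  the infimum over the empty set is \<open>\<infinity>\<close> here. This matters for the empty net,
  the only one available when \<open>M = 0\<close>.
\<close>

definition eset_dist :: "'a::real_normed_vector set \<Rightarrow> 'a set \<Rightarrow> ennreal" where
  "eset_dist A B = (INF a\<in>A. INF b\<in>B. ennreal (norm (a - b)))"

definition weak_net :: "'a::real_normed_vector itself \<Rightarrow> real \<Rightarrow> nat \<Rightarrow> ennreal" where
  "weak_net _ \<epsilon> M =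
     (SUP P\<in>{P :: 'a set. finite P \<and> 0 < diameter P}.
      INF F\<in>{F :: 'a set. finite F \<and> card F \<le> M}.
      SUP Y\<in>{Y. Y \<subseteq> P \<and> \<epsilon> * real (card P) \<le> real (card Y)}.
        eset_dist F (convex hull Y) / ennreal (diameter P))"

end

theory Submission
  imports Defs
begin

text \<open>
  By an argument of Pisier, a space of trivial type contains almost isometric copies of
  \<open>\<ell>\<^sub>1\<^sup>n\<close> for every \<open>n\<close>: otherwise the quadratic Rademacher averages of some \<open>N\<close> vectors
  improve uniformly on the triangle inequality, the improvement is submultiplicative in \<open>N\<close>, and
  it adds up to some type \<open>p > 1\<close>.

  Take \<open>P\<close> to be the almost \<open>\<ell>\<^sub>1\<close> basis \<open>y\<close>. Convex hulls of disjoint subsets of \<open>P\<close> are at distance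
  almost \<open>2\<close>, so the sets \<open>Y\<close> whose hull is closer than almost \<open>1\<close> to a given point of \<open>X\<close> intersect
  pairwise. If every \<open>k\<close>-subset of \<open>P\<close> were close to some point of \<open>F\<close>, then \<open>F\<close> would colour the
  Kneser graph of \<open>k\<close>-subsets of an \<open>n\<close>-set, which requires \<open>n - 2k + 2\<close> colours by Lovasz's
  theorem; with \<open>k \<approx> \<epsilon> n\<close> and \<open>\<epsilon> < 1/2\<close> this exceeds \<open>M\<close> for large \<open>n\<close>. Lovasz's theorem is derived,
  following Matousek, from a combinatorial lemma of Tucker, and that from Fan's parity count.
\<close>

section \<open>Tucker's lemma and the Kneser graph\<close>

fun alternating :: "bool \<Rightarrow> bool list \<Rightarrow> bool" where
  "alternating s [] \<longleftrightarrow> True"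
| "alternating s (b # bs) \<longleftrightarrow> b = s \<and> alternating (\<not> s) bs"

text \<open>Induction on the list: deleting the head leaves the tail, while deleting a later element
  keeps the head and so contributes only if the head has sign \<open>s\<close> and the shortened
  tail alternates from \<open>\<not> s\<close>. A nonempty list alternates from at most one sign, so
  for it the count is odd exactly when the list itself alternates.\<close>

lemma card_deletions_alternating:
  assumes "distinct js"
  shows "even (card {i \<in> set js. alternating s (map f (filter (\<lambda>j. j \<noteq> i) js))}) \<longleftrightarrow>
         (alternating s (map f js) \<longleftrightarrow> alternating (\<not> s) (map f js))"
  using assms
proof (induction js arbitrary: s)
  case (Cons j js)
  let ?D = "\<lambda>s js. {i \<in> set js. alternating s (map f (filter (\<lambda>j. j \<noteq> i) js))}"
  have jn: "j \<notin> set js" using Cons.prems by simp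
  have fj: "filter (\<lambda>x. x \<noteq> j) js = js" using jn by (induction js) auto
  have ne: "i \<noteq> j" if "i \<in> set js" for i using that jn by auto
  have "?D s (j # js) = (if alternating s (map f js) then {j} else {})
      \<union> (if f j = s then ?D (\<not> s) js else {})"
    using jn ne by (auto simp: fj)
  moreover have "j \<notin> ?D (\<not> s) js" using jn by simp
  moreover have "finite (?D (\<not> s) js)" by simp
  ultimately have "card (?D s (j # js)) = (if alternating s (map f js) then 1 else 0)
      + (if f j = s then card (?D (\<not> s) js) else 0)"
    by (auto simp: card_insert_if)
  then show ?case using Cons.IH[of "\<not> s"] Cons.prems by (cases "f j = s") auto
qed simp

text \<open>These are Fan's alternating simplices: read by increasing absolute value, the labels
  change sign at each step, and \<open>s\<close> tells whether the first is positive. The sort is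
  stable, so ties keep their order in \<open>js\<close> and deletion commutes with sorting.\<close>

definition sorted_alternating :: "bool \<Rightarrow> (nat \<Rightarrow> int) \<Rightarrow> nat list \<Rightarrow> bool" where
  "sorted_alternating s g js \<longleftrightarrow> alternating s (map (\<lambda>j. 0 < g j) (sort_key (\<lambda>j. \<bar>g j\<bar>) js))"

lemma card_deletions_sorted_alternating:
  assumes "distinct js"
  shows "even (card {i \<in> set js. sorted_alternating s g (filter (\<lambda>j. j \<noteq> i) js)}) \<longleftrightarrow>
         (sorted_alternating s g js \<longleftrightarrow> sorted_alternating (\<not> s) g js)"
  using card_deletions_alternating[of "sort_key (\<lambda>j. \<bar>g j\<bar>) js" s "\<lambda>j. 0 < g j"] assms
  unfolding sorted_alternating_def by (simp add: filter_sort)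

lemma insort_key_eqI: "\<forall>y \<in> insert x (set xs). k y = k' y \<Longrightarrow> insort_key k x xs = insort_key k' x xs"
  by (induction xs) simp_all

lemma sort_key_eqI: "(\<And>y. y \<in> set xs \<Longrightarrow> k y = k' y) \<Longrightarrow> sort_key k xs = sort_key k' xs"
proof (induction xs)
  case (Cons x xs)
  have "insort_key k x (sort_key k xs) = insort_key k' x (sort_key k xs)"
    by (rule insort_key_eqI) (use Cons.prems in auto)
  then show ?case using Cons by simp
qed simp

lemma sorted_alternating_cong:
  assumes "\<And>j. j \<in> set js \<Longrightarrow> g j = h j"
  shows "sorted_alternating s g js \<longleftrightarrow> sorted_alternating s h js"
proof -
  have "sort_key (\<lambda>j. \<bar>g j\<bar>) js = sort_key (\<lambda>j. \<bar>h j\<bar>) js"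
    by (rule sort_key_eqI) (simp add: assms)
  moreover have "map (\<lambda>j. 0 < g j) (sort_key k js) = map (\<lambda>j. 0 < h j) (sort_key k js)"
    for k :: "nat \<Rightarrow> int"
    by (rule map_cong) (simp_all add: assms)
  ultimately show ?thesis unfolding sorted_alternating_def by metis
qed

lemma alternating_Not: "alternating s (map Not bs) \<longleftrightarrow> alternating (\<not> s) bs"
  by (induction bs arbitrary: s) auto

text \<open>Negation keeps the order by absolute value and, in the absence of zeros, reverses every
  sign. This is the effect of the antipodal map on a simplex.\<close>

lemma sorted_alternating_uminus:
  assumes "\<And>j. j \<in> set js \<Longrightarrow> g j \<noteq> 0"
  shows "sorted_alternating s (\<lambda>j. - g j) js \<longleftrightarrow> sorted_alternating (\<not> s) g js"
proof -
  let ?l = "sort_key (\<lambda>j. \<bar>g j\<bar>) js"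
  have "map (\<lambda>j. 0 < - g j) ?l = map Not (map (\<lambda>j. 0 < g j) ?l)"
    using assms by (auto simp: not_less order_le_less)
  then show ?thesis unfolding sorted_alternating_def by (simp add: alternating_Not del: map_map)
qed

text \<open>Neighbours have opposite signs, so equal absolute values would make their sum zero. The
  case \<open>i = j\<close> of the last hypothesis excludes the label 0.\<close>

lemma alternating_imp_strict_sorted:
  fixes g :: "nat \<Rightarrow> int"
  assumes "alternating s (map (\<lambda>j. 0 < g j) js)" "sorted (map (\<lambda>j. \<bar>g j\<bar>) js)"
    and "\<And>i j. i \<in> set js \<Longrightarrow> j \<in> set js \<Longrightarrow> g i + g j \<noteq> 0"
  shows "sorted_wrt (<) (map (\<lambda>j. \<bar>g j\<bar>) js)"
  using assms
proof (induction js arbitrary: s)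
  case (Cons j js)
  have IH: "sorted_wrt (<) (map (\<lambda>j. \<bar>g j\<bar>) js)"
    by (rule Cons.IH[of "\<not> s"]) (use Cons.prems in auto)
  show ?case
  proof (cases js)
    case (Cons i is')
    have "(0 < g j) \<noteq> (0 < g i)" "\<bar>g j\<bar> \<le> \<bar>g i\<bar>"
      using Cons.prems(1,2) Cons by auto
    moreover have "g j + g i \<noteq> 0" "g j + g j \<noteq> 0" "g i + g i \<noteq> 0"
      by (rule Cons.prems(3); simp add: Cons)+
    ultimately have "\<bar>g j\<bar> < \<bar>g i\<bar>" by linarith
    then show ?thesis using IH Cons by (auto intro: less_trans)
  qed simp
qed simp

text \<open>The absolute values are distinct elements of \<open>{1..m}\<close>. Here the number of
  available labels bounds the size of an alternating simplex.\<close>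

lemma sorted_alternating_length_le:
  fixes g :: "nat \<Rightarrow> int"
  assumes "sorted_alternating s g js"
    and "\<And>i j. i \<in> set js \<Longrightarrow> j \<in> set js \<Longrightarrow> g i + g j \<noteq> 0"
    and "\<And>j. j \<in> set js \<Longrightarrow> \<bar>g j\<bar> \<le> int m"
  shows "length js \<le> m"
proof -
  let ?l = "map (\<lambda>j. \<bar>g j\<bar>) (sort_key (\<lambda>j. \<bar>g j\<bar>) js)"
  have "sorted_wrt (<) ?l"
    by (rule alternating_imp_strict_sorted[of s]) (use assms in \<open>auto simp: sorted_alternating_def\<close>)
  then have "distinct ?l" by (simp add: strict_sorted_iff)
  then have "card (set ?l) = length js" by (simp only: distinct_card) simp
  moreover have "set ?l \<subseteq> {1..int m}"
  proof
    fix v assume "v \<in> set ?l"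
    then obtain j where j: "j \<in> set js" "v = \<bar>g j\<bar>" by auto
    then have "g j \<noteq> 0" using assms(2)[of j j] by auto
    then show "v \<in> {1..int m}" using assms(3)[OF j(1)] j(2) by auto
  qed
  then have "card (set ?l) \<le> card {1..int m}" by (intro card_mono) auto
  ultimately show ?thesis by simp
qed

section \<open>Chains of signed sets and Fan's parity count\<close>

text \<open>
  A maximal chain of signed subsets of \<open>{..<d}\<close> is encoded by the order in which the signed
  elements are added; its vertices are the sets of the nonempty prefixes.
\<close>

definition full_chains :: "nat \<Rightarrow> (nat \<times> bool) list set" where
  "full_chains d = {xs. distinct (map fst xs) \<and> fst ` set xs = {..<d}}"

text \<open>The antipodal map on a single signed element.\<close>

definition flip :: "nat \<times> bool \<Rightarrow> nat \<times> bool" where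
  "flip v = (fst v, \<not> snd v)"

definition vertex_label :: "((nat \<times> bool) set \<Rightarrow> int) \<Rightarrow> (nat \<times> bool) list \<Rightarrow> nat \<Rightarrow> int" where
  "vertex_label l xs j = l (set (take (Suc j) xs))"

text \<open>The proper nonempty faces of the \<open>n\<close>-dimensional cross-polytope, that is,
  the vertices of the barycentric subdivision of its boundary. Injectivity of \<open>fst\<close>
  keeps an element from occurring with both signs.\<close>

definition signed_sets :: "nat \<Rightarrow> (nat \<times> bool) set set" where
  "signed_sets n = {V. V \<noteq> {} \<and> inj_on fst V \<and> fst ` V \<subseteq> {..<n}}"

lemma fst_flip [simp]: "fst (flip v) = fst v" and snd_flip [simp]: "snd (flip v) \<longleftrightarrow> \<not> snd v"
  and flip_flip [simp]: "flip (flip v) = v"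
  by (auto simp: flip_def)

lemma full_chains_length:
  assumes "xs \<in> full_chains d"
  shows "length xs = d"
proof -
  have "card (set (map fst xs)) = length (map fst xs)"
    using assms by (intro distinct_card) (simp add: full_chains_def)
  then show ?thesis using assms by (simp add: full_chains_def)
qed

lemma finite_full_chains: "finite (full_chains d)"
proof (rule finite_subset)
  show "full_chains d \<subseteq> {xs. set xs \<subseteq> {..<d} \<times> UNIV \<and> length xs = d}"
  proof
    fix xs assume xs: "xs \<in> full_chains d"
    then have "fst ` set xs = {..<d}" by (simp add: full_chains_def)
    then show "xs \<in> {xs. set xs \<subseteq> {..<d} \<times> UNIV \<and> length xs = d}"
      using full_chains_length[OF xs] by (auto simp: mem_Times_iff dest!: equalityD1)
  qed
  show "finite {xs. set xs \<subseteq> {..<d} \<times> (UNIV :: bool set) \<and> length xs = d}"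
    by (intro finite_lists_length_eq) auto
qed

lemma map_flip_full_chains: "map flip xs \<in> full_chains d \<longleftrightarrow> xs \<in> full_chains d"
  unfolding full_chains_def by (simp add: image_image comp_def)

lemma prefix_signed_set:
  assumes "xs \<in> full_chains d" "d \<le> n" "j < d"
  shows "set (take (Suc j) xs) \<in> signed_sets n"
proof -
  have xs: "inj_on fst (set xs)" "fst ` set xs = {..<d}" "xs \<noteq> []"
    using assms full_chains_length[OF assms(1)] by (auto simp: full_chains_def distinct_map)
  have sub: "set (take (Suc j) xs) \<subseteq> set xs" by (rule set_take_subset)
  have "fst ` set (take (Suc j) xs) \<subseteq> {..<n}"
    using image_mono[OF sub, of fst] xs(2) assms(2) by auto
  moreover have "inj_on fst (set (take (Suc j) xs))"
    using xs(1) sub by (rule inj_on_subset)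
  moreover have "set (take (Suc j) xs) \<noteq> {}" using xs(3) by simp
  ultimately show ?thesis unfolding signed_sets_def by simp
qed

text \<open>Removing an orbit \<open>{x, f x}\<close> takes away two elements and leaves a set that
  \<open>f\<close> still maps to itself.\<close>

lemma even_card_involution:
  assumes "finite S" "\<And>x. x \<in> S \<Longrightarrow> f x \<in> S" "\<And>x. x \<in> S \<Longrightarrow> f (f x) = x" "\<And>x. x \<in> S \<Longrightarrow> f x \<noteq> x"
  shows "even (card S)"
  using assms
proof (induction "card S" arbitrary: S rule: less_induct)
  case less
  show ?case
  proof (cases "S = {}")
    case False
    then obtain x where x: "x \<in> S" by auto
    let ?S = "S - {x, f x}"
    have fx: "f x \<in> S" "f x \<noteq> x" using less x by auto
    have "card {x, f x} = 2" using fx by simp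
    moreover have "card {x, f x} \<le> card S"
      using x fx less.prems(1) by (intro card_mono) auto
    moreover have "card ?S = card S - card {x, f x}"
      using x fx by (intro card_Diff_subset) auto
    ultimately have c: "card S = card ?S + 2" by linarith
    have "even (card ?S)"
    proof (rule less.hyps)
      fix y assume y: "y \<in> ?S"
      then have "f y \<noteq> x" "f y \<noteq> f x" using less.prems(3)[of y] less.prems(3)[of x] x by auto
      then show "f y \<in> ?S" using less.prems(2) y by auto
    qed (use c less.prems in auto)
    then show ?thesis using c by simp
  qed simp
qed

text \<open>
  Fan's parity count. In the hemisphere \<open>H\<close> of the sphere of dimension \<open>d\<close>, count the pairs of a
  maximal chain and an alternating facet of it. A chain has an odd number of such facets iff it
  alternates itself (with either first sign), while a facet lies in two chains of \<open>H\<close> unless it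
  belongs to the equator, whose chains are those of the sphere of dimension \<open>d - 1\<close>.
\<close>

lemma odd_card_alternating_full_chains:
  assumes nz: "\<And>V. V \<in> signed_sets n \<Longrightarrow> l V \<noteq> 0"
    and odd: "\<And>V. V \<in> signed_sets n \<Longrightarrow> l (flip ` V) = - l V"
    and "d \<le> n"
  shows "odd (card {xs \<in> full_chains d. sorted_alternating True (vertex_label l xs) [0..<d]})"
  using \<open>d \<le> n\<close>
proof (induction d)
  case 0
  \<comment> \<open>The only chain is the empty list, which counts as alternating, so the count
    starts at one.\<close>
  have "{xs \<in> full_chains 0. sorted_alternating True (vertex_label l xs) [0..<0]} = {[]}"
    by (auto simp: full_chains_def sorted_alternating_def)
  then show ?case by simp
next
  case (Suc d)
  define alt where "alt s xs = sorted_alternating s (vertex_label l xs) [0..<Suc d]" for s xs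
  \<comment> \<open>\<open>G xs i\<close> says that the facet opposite to vertex \<open>i\<close>
    alternates from a positive label.\<close>
  define G where "G xs i = sorted_alternating True (vertex_label l xs) (filter (\<lambda>j. j \<noteq> i) [0..<Suc d])"
    for xs i
  define H where "H = {xs \<in> full_chains (Suc d). (d, True) \<in> set xs}"
  define Q where "Q = (SIGMA xs:H. {i \<in> set [0..<Suc d]. G xs i})"
  \<comment> \<open>The equatorial facets: if \<open>(d, True)\<close> is added last, removing the
    top vertex leaves a chain on \<open>{..<d}\<close>.\<close>
  define Q' where "Q' = {(xs, i). (xs, i) \<in> Q \<and> i = d \<and> xs ! d = (d, True)}"
  have finH: "finite H" unfolding H_def using finite_full_chains by simp
  then have finQ: "finite Q" unfolding Q_def by auto
  have len: "length xs = Suc d" if "xs \<in> H" for xs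
    using that full_chains_length unfolding H_def by blast
  have not_both: "\<not> (alt True xs \<and> alt False xs)" for xs
  proof -
    obtain j js where "sort_key (\<lambda>j. \<bar>vertex_label l xs j\<bar>) [0..<Suc d] = j # js"
      by (metis length_0_conv length_sort length_upt diff_zero nat.simps(3) list.exhaust)
    then show ?thesis unfolding alt_def sorted_alternating_def by auto
  qed

  \<comment> \<open>First count of \<open>Q\<close>, chain by chain; modulo 2 only the chains that
    alternate themselves remain.\<close>
  have "card Q = (\<Sum>xs\<in>H. card {i \<in> set [0..<Suc d]. G xs i})"
    unfolding Q_def using finH by (intro card_SigmaI) auto
  then have "even (card Q) \<longleftrightarrow> even (card {xs \<in> H. odd (card {i \<in> set [0..<Suc d]. G xs i})})"
    using finH by (simp only: even_sum_iff)
  also have "{xs \<in> H. odd (card {i \<in> set [0..<Suc d]. G xs i})} = {xs \<in> H. alt True xs} \<union> {xs \<in> H. alt False xs}"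
    using not_both card_deletions_sorted_alternating[of "[0..<Suc d]" True]
    unfolding G_def alt_def by auto
  also have "card \<dots> = card {xs \<in> H. alt True xs} + card {xs \<in> H. alt False xs}"
    using finH not_both by (intro card_Un_disjoint) auto
  \<comment> \<open>The antipodal map exchanges the two hemispheres and the two first signs. The
    count over \<open>H\<close> with either first sign thus becomes a count over all chains with
    first sign \<open>True\<close>.\<close>
  also have "card {xs \<in> H. alt False xs} = card {xs \<in> full_chains (Suc d) - H. alt True xs}"
  proof (rule bij_betw_same_card)
    have mf: "map flip xs \<in> full_chains (Suc d) - H \<longleftrightarrow> xs \<in> H" if "xs \<in> full_chains (Suc d)" for xs
    proof -
      have inj: "inj_on fst (set xs)" and "fst ` set xs = {..<Suc d}"
        using that by (auto simp: full_chains_def distinct_map)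
      then obtain v where v: "v \<in> set xs" "fst v = d" by (metis imageE lessI lessThan_iff)
      have uniq: "w = v" if "w \<in> set xs" "fst w = d" for w
        using inj that v by (auto dest: inj_onD)
      have mem: "(d, b) \<in> set xs \<longleftrightarrow> v = (d, b)" for b
        using v uniq[of "(d, b)"] by auto
      have "(d, True) = flip w \<longleftrightarrow> w = (d, False)" for w by (cases w) (auto simp: flip_def)
      then have "(d, True) \<in> set (map flip xs) \<longleftrightarrow> v = (d, False)"
        using mem[of False] by (auto simp: image_iff)
      moreover note mem[of True]
      moreover have "v = (d, True) \<or> v = (d, False)" using v(2) by (cases v) auto
      ultimately show ?thesis using that map_flip_full_chains[of xs] unfolding H_def by auto
    qed
    have alt_flip: "alt True (map flip xs) \<longleftrightarrow> alt False xs" if "xs \<in> full_chains (Suc d)" for xs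
    proof -
      have "vertex_label l (map flip xs) j = - vertex_label l xs j" if "j < Suc d" for j
        using odd[OF prefix_signed_set[OF \<open>xs \<in> full_chains (Suc d)\<close> Suc.prems that]]
        by (simp add: vertex_label_def take_map image_image)
      then have "alt True (map flip xs) \<longleftrightarrow> sorted_alternating True (\<lambda>j. - vertex_label l xs j) [0..<Suc d]"
        unfolding alt_def by (intro sorted_alternating_cong) auto
      also have "\<dots> \<longleftrightarrow> alt False xs"
        unfolding alt_def using nz[OF prefix_signed_set[OF that Suc.prems]]
        by (subst sorted_alternating_uminus) (auto simp: vertex_label_def)
      finally show ?thesis .
    qed
    have fm: "map flip (map flip xs) = xs" for xs by (simp add: comp_def)
    show "bij_betw (map flip) {xs \<in> H. alt False xs} {xs \<in> full_chains (Suc d) - H. alt True xs}"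
    proof (rule bij_betw_byWitness[where f' = "map flip"])
      have sub: "xs \<in> full_chains (Suc d)" if "xs \<in> H" for xs using that by (simp add: H_def)
      show "map flip ` {xs \<in> H. alt False xs} \<subseteq> {xs \<in> full_chains (Suc d) - H. alt True xs}"
        using mf alt_flip sub by blast
      show "map flip ` {xs \<in> full_chains (Suc d) - H. alt True xs} \<subseteq> {xs \<in> H. alt False xs}"
      proof (rule image_subsetI)
        fix xs assume xs: "xs \<in> {xs \<in> full_chains (Suc d) - H. alt True xs}"
        then have m: "map flip xs \<in> full_chains (Suc d)" by (simp add: map_flip_full_chains)
        show "map flip xs \<in> {xs \<in> H. alt False xs}"
          using mf[OF m] alt_flip[OF m] xs unfolding fm by simp
      qed
    qed (use fm in auto)
  qed
  also have "card {xs \<in> H. alt True xs} + card {xs \<in> full_chains (Suc d) - H. alt True xs}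
      = card ({xs \<in> H. alt True xs} \<union> {xs \<in> full_chains (Suc d) - H. alt True xs})"
    using finH finite_full_chains by (intro card_Un_disjoint[symmetric]) auto
  also have "{xs \<in> H. alt True xs} \<union> {xs \<in> full_chains (Suc d) - H. alt True xs}
      = {xs \<in> full_chains (Suc d). alt True xs}"
    unfolding H_def by auto
  finally have QF: "even (card Q) \<longleftrightarrow> even (card {xs \<in> full_chains (Suc d). alt True xs})" .

  \<comment> \<open>The other chain through the same facet. Exchanging the elements added at steps
    \<open>i\<close> and \<open>Suc i\<close> changes only the prefix set number \<open>i\<close>;
    for the top vertex, the sign of the last element is flipped instead.\<close>
  define swp where "swp = (\<lambda>(xs, i). (if i < d then xs[i := xs ! Suc i, Suc i := xs ! i]
      else xs[d := flip (xs ! d)], i))" for xs :: "(nat \<times> bool) list" and i :: nat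
  have lab_eq: "G xs i \<longleftrightarrow> G ys i"
    if "\<And>j. j < Suc d \<Longrightarrow> j \<noteq> i \<Longrightarrow> set (take (Suc j) xs) = set (take (Suc j) ys)" for xs ys i
    unfolding G_def by (rule sorted_alternating_cong) (use that in \<open>auto simp: vertex_label_def simp del: upt_Suc\<close>)
  have "even (card (Q - Q'))"
  proof (rule even_card_involution[where f = swp])
    fix q assume q: "q \<in> Q - Q'"
    obtain xs i where qxs: "q = (xs, i)" by (cases q)
    have xsH: "xs \<in> H" and i: "i < Suc d" and G: "G xs i"
      and nlast: "\<not> (i = d \<and> xs ! d = (d, True))"
      using q unfolding qxs Q_def Q'_def by auto
    have lxs: "length xs = Suc d" using len[OF xsH] .
    have dist: "distinct (map fst xs)" and fs: "fst ` set xs = {..<Suc d}" and dT: "(d, True) \<in> set xs"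
      using xsH unfolding H_def full_chains_def by auto
    have "swp q \<in> Q - Q' \<and> swp (swp q) = q \<and> swp q \<noteq> q"
    proof (cases "i < d")
      case True
      let ?ys = "xs[i := xs ! Suc i, Suc i := xs ! i]"
      have set_ys: "set ?ys = set xs" using True lxs by (intro set_swap) auto
      have "mset (map fst ?ys) = mset (map fst xs)" using True lxs by (simp add: mset_swap)
      then have "distinct (map fst ?ys)" using dist mset_eq_imp_distinct_iff by blast
      then have ysH: "?ys \<in> H" unfolding H_def full_chains_def using set_ys fs dT by simp
      have "set (take (Suc j) xs) = set (take (Suc j) ?ys)" if "j < Suc d" "j \<noteq> i" for j
      proof (cases "j < i")
        case False
        then have "take (Suc j) ?ys = (take (Suc j) xs)[i := take (Suc j) xs ! Suc i, Suc i := take (Suc j) xs ! i]"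
          using that by (simp add: take_update_swap)
        also have "set \<dots> = set (take (Suc j) xs)"
          using False that lxs by (intro set_swap) auto
        finally show ?thesis by simp
      qed simp
      then have "G ?ys i" using G lab_eq by blast
      then have "(?ys, i) \<in> Q - Q'" using ysH i True unfolding Q_def Q'_def by auto
      moreover have "?ys[i := ?ys ! Suc i, Suc i := ?ys ! i] = xs"
        using True lxs by (intro nth_equalityI) (auto simp: nth_list_update)
      moreover have "?ys \<noteq> xs"
      proof
        assume "?ys = xs"
        then have "xs ! i = xs ! Suc i"
          using True lxs by (metis nth_list_update_eq length_list_update Suc_mono less_SucI)
        then show False using dist True lxs
          by (metis Suc_mono less_SucI distinct_map nth_eq_iff_index_eq n_not_Suc_n)
      qed
      ultimately show ?thesis using True unfolding qxs swp_def by simp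
    next
      case False
      then have id: "i = d" using i by simp
      let ?ys = "xs[d := flip (xs ! d)]"
      have mys: "map fst ?ys = map fst xs"
        using lxs by (simp add: map_update list_update_same_conv)
      have "fst ` set ?ys = fst ` set xs" using mys by (metis list.set_map)
      \<comment> \<open>Outside \<open>Q'\<close> the element \<open>(d, True)\<close> is not the
        last one, so it survives the flip and the new chain stays in \<open>H\<close>.\<close>
      moreover obtain k where k: "k < Suc d" "xs ! k = (d, True)"
        using dT lxs by (metis in_set_conv_nth)
      have kd: "k \<noteq> d" using nlast id k by auto
      then have ysk: "?ys ! k = (d, True)" using k by simp
      then have "(d, True) \<in> set ?ys" using k lxs by (metis length_list_update nth_mem)
      ultimately have ysH: "?ys \<in> H" unfolding H_def full_chains_def using mys fs dist by simp
      have "set (take (Suc j) xs) = set (take (Suc j) ?ys)" if "j < Suc d" "j \<noteq> i" for j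
        using that id by simp
      then have "G ?ys i" using G lab_eq by blast
      moreover have "?ys ! d \<noteq> (d, True)"
      proof
        assume "?ys ! d = (d, True)"
        then have "map fst ?ys ! d = map fst ?ys ! k" using ysk k lxs by simp
        then show False using kd k dist lxs unfolding mys
          by (metis length_map lessI nth_eq_iff_index_eq)
      qed
      ultimately have "(?ys, i) \<in> Q - Q'" using ysH i unfolding Q_def Q'_def by auto
      moreover have "?ys[d := flip (?ys ! d)] = xs" using lxs by simp
      moreover have "?ys \<noteq> xs"
      proof
        assume "?ys = xs"
        then have "flip (xs ! d) = xs ! d" using lxs by (metis lessI nth_list_update_eq)
        then show False by (metis snd_flip)
      qed
      ultimately show ?thesis using id unfolding qxs swp_def by simp
    qed
    then show "swp q \<in> Q - Q'" "swp (swp q) = q" "swp q \<noteq> q" by auto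
  qed (use finQ in simp)
  \<comment> \<open>Appending \<open>(d, True)\<close> identifies the chains of the lower sphere
    with the equatorial pairs, so the induction hypothesis counts \<open>Q'\<close>.\<close>
  moreover have "card Q' = card {ys \<in> full_chains d. sorted_alternating True (vertex_label l ys) [0..<d]}"
  proof (rule bij_betw_same_card[symmetric])
    let ?Y = "{ys \<in> full_chains d. sorted_alternating True (vertex_label l ys) [0..<d]}"
    have G_snoc: "G (ys @ [v]) d \<longleftrightarrow> sorted_alternating True (vertex_label l ys) [0..<d]"
      if "length ys = d" for ys v
    proof -
      have "filter (\<lambda>j. j \<noteq> d) [0..<Suc d] = [0..<d]" by (simp add: filter_id_conv)
      then show ?thesis unfolding G_def
        by (simp only:) (rule sorted_alternating_cong, use that in \<open>auto simp: vertex_label_def\<close>)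
    qed
    have fc_snoc: "ys @ [(d, True)] \<in> full_chains (Suc d) \<longleftrightarrow> ys \<in> full_chains d" for ys
      unfolding full_chains_def lessThan_Suc by (auto simp: lessThan_def)
    show "bij_betw (\<lambda>ys. (ys @ [(d, True)], d)) ?Y Q'"
    proof (intro bij_betwI')
      show "(\<lambda>ys. (ys @ [(d, True)], d)) ys \<in> Q'" if "ys \<in> ?Y" for ys
        using that full_chains_length[of ys d] fc_snoc[of ys] G_snoc[of ys]
        unfolding Q'_def Q_def H_def by (auto simp: nth_append)
      show "\<exists>ys\<in>?Y. q = (ys @ [(d, True)], d)" if qQ: "q \<in> Q'" for q
      proof -
        obtain xs where q: "q = (xs, d)" and xs: "xs \<in> H" "G xs d" "xs ! d = (d, True)"
          using qQ unfolding Q'_def Q_def by (cases q) (auto simp del: upt_Suc)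
        have l: "length xs = Suc d" using len xs by simp
        have snoc: "xs = take d xs @ [(d, True)]"
          using take_Suc_conv_app_nth[of d xs] l xs(3) by simp
        have "xs \<in> full_chains (Suc d)" using xs unfolding H_def by simp
        then have "take d xs \<in> full_chains d" using fc_snoc[of "take d xs"] snoc by simp
        moreover have "sorted_alternating True (vertex_label l (take d xs)) [0..<d]"
          using G_snoc[of "take d xs" "(d, True)"] snoc l xs(2) by simp
        ultimately show ?thesis using q snoc by blast
      qed
    qed auto
  qed
  moreover have "card Q = card (Q - Q') + card Q'"
  proof -
    have "Q' \<subseteq> Q" unfolding Q'_def by auto
    then show ?thesis using finQ
      by (metis card_Diff_subset card_mono finite_subset le_add_diff_inverse2)
  qed
  ultimately show ?case using QF Suc unfolding alt_def by simp
qed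

section \<open>Tucker's lemma and the chromatic number of the Kneser graph\<close>

text \<open>Otherwise no label is 0 (take \<open>V = W\<close>), and Fan's count gives an
  alternating maximal chain. Its \<open>n\<close> labels have distinct absolute values in
  \<open>{1..m}\<close>, which is impossible for \<open>m < n\<close>.\<close>

lemma octahedral_Tucker:
  assumes "\<And>V. V \<in> signed_sets n \<Longrightarrow> l (flip ` V) = - l V"
    and "\<And>V. V \<in> signed_sets n \<Longrightarrow> \<bar>l V\<bar> \<le> int m"
    and "m < n"
  shows "\<exists>V\<in>signed_sets n. \<exists>W\<in>signed_sets n. V \<subseteq> W \<and> l V + l W = 0"
proof (rule ccontr)
  assume neg: "\<not> ?thesis"
  then have "l V \<noteq> 0" if "V \<in> signed_sets n" for V
    using that by (metis add.right_neutral order_refl)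
  then have "odd (card {xs \<in> full_chains n. sorted_alternating True (vertex_label l xs) [0..<n]})"
    using assms(1) by (intro odd_card_alternating_full_chains) auto
  then have "{xs \<in> full_chains n. sorted_alternating True (vertex_label l xs) [0..<n]} \<noteq> {}"
    by (metis card.empty even_zero)
  then obtain xs where xs: "xs \<in> full_chains n" "sorted_alternating True (vertex_label l xs) [0..<n]"
    by auto
  note ps = prefix_signed_set[OF xs(1) order_refl]
  have le: "vertex_label l xs i + vertex_label l xs j \<noteq> 0" if "i \<le> j" "j < n" for i j
    using neg ps[of i] ps[of j] set_take_subset_set_take[of "Suc i" "Suc j" xs] that
    unfolding vertex_label_def by auto
  have "length [0..<n] \<le> m"
  proof (rule sorted_alternating_length_le[OF xs(2)])
    fix i j assume "i \<in> set [0..<n]" "j \<in> set [0..<n]"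
    then show "vertex_label l xs i + vertex_label l xs j \<noteq> 0"
      using le[of i j] le[of j i] by (cases "i \<le> j") (auto simp: add.commute)
  next
    fix j assume "j \<in> set [0..<n]"
    then show "\<bar>vertex_label l xs j\<bar> \<le> int m"
      using assms(2)[OF ps[of j]] by (simp add: vertex_label_def)
  qed
  then show False using assms(3) by simp
qed

text \<open>A proper colouring with \<open>M\<close> colours, one short of \<open>n - 2k + 2\<close>
  at most, yields an antipodal labelling of signed sets that contradicts Tucker's lemma.\<close>

theorem Lovasz_Kneser:
  fixes c :: "nat set \<Rightarrow> nat"
  assumes k: "0 < k" and n: "M + 2 * k \<le> n + 1"
    and c: "\<And>Y. Y \<subseteq> {..<n} \<Longrightarrow> card Y = k \<Longrightarrow> c Y < M"
  shows "\<exists>Y Z. Y \<subseteq> {..<n} \<and> Z \<subseteq> {..<n} \<and> card Y = k \<and> card Z = k \<and> Y \<inter> Z = {} \<and> c Y = c Z"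
proof (rule ccontr)
  assume neg: "\<not> ?thesis"
  define side where "side s V = {i. (i, s) \<in> V}" for s and V :: "(nat \<times> bool) set"
  define has_col where "has_col s V j \<longleftrightarrow> (\<exists>Y. Y \<subseteq> side s V \<and> card Y = k \<and> c Y = j)" for s V j
  define J where "J V = (LEAST j. \<exists>s. has_col s V j)" for V
  \<comment> \<open>Small sets are labelled by their size, with the sign of their least element;
    large ones by the least colour \<open>J V\<close> found on one side, shifted by
    \<open>2 * k - 1\<close>, with the side as sign. The two ranges are disjoint, and the absolute
    values are at most \<open>2 * k - 2 + M \<le> n - 1\<close>.\<close>
  define l :: "(nat \<times> bool) set \<Rightarrow> int" where
    "l V = (if card V < 2 * k - 1 then (if (Min (fst ` V), True) \<in> V then int (card V) else - int (card V))
      else (if has_col True V (J V) then int (2 * k - 1 + J V) else - int (2 * k - 1 + J V)))" for V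
  have mem_flip: "(i, s) \<in> flip ` V \<longleftrightarrow> (i, \<not> s) \<in> V" for i s V
    by (force simp: flip_def)
  have mem_fst: "i \<in> fst ` V \<longleftrightarrow> (i, True) \<in> V \<or> (i, False) \<in> V" for i and V :: "(nat \<times> bool) set"
    by (simp add: image_iff Bex_def split_paired_Ex ex_bool_eq disj_commute)
  have side_sub: "side s V \<subseteq> {..<n}" if "V \<in> signed_sets n" for s V
  proof
    fix i assume "i \<in> side s V"
    then have "i \<in> fst ` V" unfolding mem_fst side_def by (cases s) auto
    then show "i \<in> {..<n}" using that unfolding signed_sets_def by blast
  qed
  have side_disj: "side True V \<inter> side False V = {}" if "V \<in> signed_sets n" for V
  proof -
    have "inj_on fst V" using that by (simp add: signed_sets_def)
    then have "\<not> ((i, True) \<in> V \<and> (i, False) \<in> V)" for i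
      using inj_onD[of fst V "(i, True)" "(i, False)"] by auto
    then show ?thesis unfolding side_def by blast
  qed
  have card_V: "finite V \<and> card V = card (side True V) + card (side False V)" if V: "V \<in> signed_sets n" for V
  proof -
    have "fst ` V = side True V \<union> side False V"
      using mem_fst unfolding side_def by blast
    moreover have "inj_on fst V" using V by (simp add: signed_sets_def)
    moreover have "finite (side s V)" for s using side_sub[OF V] finite_subset by blast
    ultimately show ?thesis using side_disj[OF V]
      by (metis card_Un_disjoint card_image finite_UnI finite_imageD)
  qed
  \<comment> \<open>The two sides of \<open>V\<close> are disjoint, so a colour on both would give
    the desired pair.\<close>
  have not_both: False if V: "V \<in> signed_sets n" and T: "has_col True V j" and F: "has_col False V j" for V j
  proof -
    obtain Y where "Y \<subseteq> side True V" "card Y = k" "c Y = j" using T has_col_def by blast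
    moreover obtain Z where "Z \<subseteq> side False V" "card Z = k" "c Z = j" using F has_col_def by blast
    ultimately show False using neg side_disj[OF V] side_sub[OF V] by blast
  qed
  \<comment> \<open>By pigeonhole, one side of a set with \<open>2 * k - 1\<close> elements has at
    least \<open>k\<close> of them, so the \<open>LEAST\<close> in \<open>J\<close> is
    attained.\<close>
  have large: "(\<exists>s. has_col s V (J V)) \<and> J V < M" if V: "V \<in> signed_sets n" and "2 * k - 1 \<le> card V" for V
  proof -
    have "k \<le> card (side True V) \<or> k \<le> card (side False V)"
      using card_V[OF V] that(2) by linarith
    then obtain s where "k \<le> card (side s V)" by auto
    then obtain Y where "Y \<subseteq> side s V" "card Y = k" by (meson obtain_subset_with_card_n)
    then have "\<exists>j s. has_col s V j" unfolding has_col_def by blast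
    then have ex: "\<exists>s. has_col s V (J V)" unfolding J_def by (rule LeastI_ex)
    then obtain s Y where Y: "Y \<subseteq> side s V" "card Y = k" "c Y = J V" unfolding has_col_def by blast
    then have "J V < M" using c[of Y] side_sub[OF V, of s] by force
    then show ?thesis using ex by simp
  qed
  have "\<exists>V\<in>signed_sets n. \<exists>W\<in>signed_sets n. V \<subseteq> W \<and> l V + l W = 0"
  proof (rule octahedral_Tucker[where m = "n - 1"])
    show "n - 1 < n" using k n by simp
    fix V assume V: "V \<in> signed_sets n"
    show "\<bar>l V\<bar> \<le> int (n - 1)"
      using large[OF V] k n unfolding l_def by (auto simp: not_less)
    have cardf: "card (flip ` V) = card V"
      by (rule card_image) (metis flip_flip inj_on_def)
    have monof: "has_col s (flip ` V) j \<longleftrightarrow> has_col (\<not> s) V j" for s j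
      unfolding has_col_def side_def mem_flip by simp
    have "(\<exists>s. has_col s (flip ` V) j) \<longleftrightarrow> (\<exists>s. has_col s V j)" for j
      by (auto simp: monof ex_bool_eq)
    then have Jf: "J (flip ` V) = J V" unfolding J_def by simp
    have fstf: "fst ` flip ` V = fst ` V" by (simp add: image_image)
    have "Min (fst ` V) \<in> fst ` V"
      using V card_V[OF V] by (intro Min_in) (auto simp: signed_sets_def)
    moreover define i where "i = Min (fst ` V)"
    ultimately have "(i, True) \<in> V \<or> (i, False) \<in> V"
      unfolding mem_fst by simp
    then have "(i, True) \<in> flip ` V \<longleftrightarrow> (i, True) \<notin> V"
      using side_disj[OF V] unfolding mem_flip side_def by auto
    moreover have "has_col True (flip ` V) (J V) \<longleftrightarrow> \<not> has_col True V (J V)" if "2 * k - 1 \<le> card V"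
      using large[OF V that] not_both[OF V] unfolding monof by (metis (full_types))
    ultimately show "l (flip ` V) = - l V"
      unfolding l_def cardf Jf fstf i_def by (auto simp: not_less)
  qed
  then obtain V W where V: "V \<in> signed_sets n" and W: "W \<in> signed_sets n" and VW: "V \<subseteq> W"
    and sum: "l V + l W = 0" by blast
  have "V \<noteq> {}" "finite V" using V card_V[OF V] by (simp_all add: signed_sets_def)
  then have pos: "0 < card V" by (simp add: card_gt_0_iff)
  have le: "card V \<le> card W" using VW card_V[OF W] by (intro card_mono) auto
  show False
  proof (cases "card W < 2 * k - 1")
    case True
    then have "card V = card W" using sum le unfolding l_def by (auto split: if_splits)
    then have "V = W" using VW card_V[OF W] by (metis card_subset_eq)
    then show False using sum pos True unfolding l_def by (auto split: if_splits)
  next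
    case False
    show False
    proof (cases "card V < 2 * k - 1")
      case True
      then show False using sum False unfolding l_def by (auto split: if_splits)
    next
      case Vl: False
      \<comment> \<open>The same colour occurs on opposite sides of \<open>V\<close> and
        \<open>W\<close>. As \<open>V \<subseteq> W\<close>, both occurrences lie in
        \<open>W\<close>.\<close>
      have "J V = J W" and opp: "has_col True V (J V) \<longleftrightarrow> \<not> has_col True W (J W)"
        using sum False Vl k unfolding l_def by (auto split: if_splits)
      moreover have mn: "has_col s V j \<Longrightarrow> has_col s W j" for s j
        using VW unfolding has_col_def side_def by blast
      ultimately show False
        using large[OF V] large[OF W] False Vl not_both[OF W] by (metis (full_types) not_less)
    qed
  qed
qed

section \<open>Trivial type and copies of l1\<close>

text \<open>A choice of signs is encoded by the set \<open>T\<close> of indices with sign -1, so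
  that expectations become sums over \<open>Pow A\<close> divided by
  \<open>2 ^ card A\<close>.\<close>

definition rsign :: "'b set \<Rightarrow> 'b \<Rightarrow> real" where
  "rsign T i = (if i \<in> T then -1 else 1)"

definition rsum :: "('b \<Rightarrow> 'a::real_normed_vector) \<Rightarrow> 'b set \<Rightarrow> 'b set \<Rightarrow> 'a" where
  "rsum x A T = (\<Sum>i\<in>A. rsign T i *\<^sub>R x i)"

text \<open>\<open>b\<close> bounds the squared constant of the type-2 inequality for \<open>n\<close> vectors, divided by \<open>n\<close>;
  the triangle inequality always gives \<open>b = 1\<close>.\<close>

definition rad_bound :: "'a::real_normed_vector itself \<Rightarrow> real \<Rightarrow> nat \<Rightarrow> bool" where
  "rad_bound _ b n \<longleftrightarrow> (\<forall>(A :: nat set) (x :: nat \<Rightarrow> 'a). finite A \<and> card A \<le> n \<longrightarrow>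
     (\<Sum>T\<in>Pow A. (norm (rsum x A T))\<^sup>2) \<le> 2 ^ card A * (b * real n * (\<Sum>i\<in>A. (norm (x i))\<^sup>2)))"

lemma rad_boundD:
  fixes x :: "nat \<Rightarrow> 'a::real_normed_vector"
  assumes "rad_bound TYPE('a) b n" "finite A" "card A \<le> n"
  shows "(\<Sum>T\<in>Pow A. (norm (rsum x A T))\<^sup>2) \<le> 2 ^ card A * (b * real n * (\<Sum>i\<in>A. (norm (x i))\<^sup>2))"
  using assms unfolding rad_bound_def by blast

lemma norm_rsum_le: "norm (rsum x A T) \<le> (\<Sum>i\<in>A. norm (x i))"
  unfolding rsum_def by (rule order_trans[OF norm_sum]) (auto simp: rsign_def intro!: sum_mono)

lemma sum_Pow_Int:
  fixes h :: "'b set \<Rightarrow> real"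
  assumes "finite A" "B \<subseteq> A"
  shows "(\<Sum>T\<in>Pow A. h (T \<inter> B)) = 2 ^ card (A - B) * (\<Sum>T\<in>Pow B. h T)"
proof -
  have "(\<Sum>T\<in>Pow A. h (T \<inter> B)) = (\<Sum>(U, V)\<in>Pow B \<times> Pow (A - B). h U)"
    by (rule sum.reindex_bij_witness[where i = "\<lambda>(U, V). U \<union> V" and j = "\<lambda>T. (T \<inter> B, T - B)"])
      (use assms(2) in \<open>auto intro!: arg_cong[where f = h]\<close>)
  also have "\<dots> = (\<Sum>U\<in>Pow B. \<Sum>V\<in>Pow (A - B). h U)" by (rule sum.cartesian_product[symmetric])
  also have "\<dots> = 2 ^ card (A - B) * (\<Sum>T\<in>Pow B. h T)"
    using assms(1) by (simp add: card_Pow sum_distrib_left)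
  finally show ?thesis .
qed

lemma sum_Pow_rsum_subset:
  assumes "finite A" "B \<subseteq> A"
  shows "(\<Sum>T\<in>Pow A. (norm (rsum x B T))\<^sup>2) = 2 ^ card (A - B) * (\<Sum>T\<in>Pow B. (norm (rsum x B T))\<^sup>2)"
proof -
  have "rsum x B (T \<inter> B) = rsum x B T" for T
    unfolding rsum_def by (rule sum.cong) (auto simp: rsign_def)
  then show ?thesis using sum_Pow_Int[OF assms, of "\<lambda>T. (norm (rsum x B T))\<^sup>2"] by simp
qed

text \<open>Signs outside \<open>B\<close> do not affect the sum over \<open>B\<close>; each choice
  on \<open>B\<close> is merely repeated \<open>2 ^ card (A - B)\<close> times.\<close>

lemma sum_Pow_rsum_le_of_rad_bound:
  fixes x :: "nat \<Rightarrow> 'a::real_normed_vector"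
  assumes "rad_bound TYPE('a) b n" "finite A" "B \<subseteq> A" "card B \<le> n"
  shows "(\<Sum>T\<in>Pow A. (norm (rsum x B T))\<^sup>2) \<le> 2 ^ card A * (b * real n * (\<Sum>i\<in>B. (norm (x i))\<^sup>2))"
proof -
  have B: "finite B" using assms(2,3) finite_subset by blast
  have "card A = card (A - B) + card B"
    using assms(2,3) B by (simp add: card_Diff_subset card_mono)
  then have pow: "2 ^ card A = (2 ^ card (A - B) * 2 ^ card B :: real)" by (simp add: power_add)
  show ?thesis
    using mult_left_mono[OF rad_boundD[OF assms(1) B assms(4), of x], of "2 ^ card (A - B)"]
    unfolding sum_Pow_rsum_subset[OF assms(2,3)] pow by (simp only: mult.assoc) simp
qed

lemma rad_bound_1_1: "rad_bound TYPE('a::real_normed_vector) 1 1"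
  unfolding rad_bound_def
proof (intro allI impI)
  fix A :: "nat set" and x :: "nat \<Rightarrow> 'a"
  assume A: "finite A \<and> card A \<le> 1"
  have "(norm (rsum x A T))\<^sup>2 \<le> (\<Sum>i\<in>A. (norm (x i))\<^sup>2)" for T
  proof (cases "card A = 0")
    case False
    then have "card A = 1" using A by linarith
    then obtain a where "A = {a}" by (rule card_1_singletonE)
    then show ?thesis by (simp add: rsum_def rsign_def)
  qed (use A in \<open>simp add: rsum_def\<close>)
  then have "(\<Sum>T\<in>Pow A. (norm (rsum x A T))\<^sup>2) \<le> (\<Sum>T\<in>Pow A. \<Sum>i\<in>A. (norm (x i))\<^sup>2)"
    by (rule sum_mono)
  then show "(\<Sum>T\<in>Pow A. (norm (rsum x A T))\<^sup>2) \<le> 2 ^ card A * (1 * real 1 * (\<Sum>i\<in>A. (norm (x i))\<^sup>2))"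
    using A by (simp add: card_Pow)
qed

text \<open>The signs are randomised twice: flipping the signs of whole blocks at random does not
  change the distribution of the sum.\<close>

lemma rad_bound_mult:
  assumes b: "rad_bound TYPE('a::real_normed_vector) b m" "0 \<le> b" and c: "rad_bound TYPE('a) c n"
    and n: "0 < n"
  shows "rad_bound TYPE('a) (b * c) (m * n)"
  unfolding rad_bound_def
proof (intro allI impI)
  fix A :: "nat set" and x :: "nat \<Rightarrow> 'a"
  assume A: "finite A \<and> card A \<le> m * n"
  then obtain h where h: "bij_betw h A {..<card A}"
    using ex_bij_betw_finite_nat by (metis atLeast0LessThan)
  \<comment> \<open>An enumeration of \<open>A\<close> is cut into at most \<open>m\<close> blocks
    of at most \<open>n\<close> consecutive elements.\<close>
  define \<beta> where "\<beta> i = h i div n" for i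
  define B where "B j = {i \<in> A. \<beta> i = j}" for j
  have beta: "\<beta> i < m" if "i \<in> A" for i
  proof -
    have "h i < card A" using bij_betw_apply[OF h that] by simp
    then have "h i < m * n" using A by linarith
    then show ?thesis unfolding \<beta>_def by (simp add: less_mult_imp_div_less)
  qed
  have card_B: "card (B j) \<le> n" for j
  proof -
    have "card (B j) = card (h ` B j)"
      using h unfolding bij_betw_def B_def by (intro card_image[symmetric]) (auto intro: inj_on_subset)
    also have "\<dots> \<le> card {j * n..<j * n + n}"
    proof (rule card_mono)
      show "h ` B j \<subseteq> {j * n..<j * n + n}"
      proof
        fix v assume "v \<in> h ` B j"
        then have "v div n = j" unfolding B_def \<beta>_def by auto
        then show "v \<in> {j * n..<j * n + n}"
          using n div_mult_mod_eq[of v n] mod_less_divisor[OF n, of v] by (simp only: atLeastLessThan_iff) linarith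
      qed
    qed simp
    finally show ?thesis by simp
  qed
  have split: "(\<Sum>i\<in>A. g i) = (\<Sum>j<m. \<Sum>i\<in>B j. g i)" for g :: "nat \<Rightarrow> 'b::comm_monoid_add"
    unfolding B_def using A beta by (intro sum.group[symmetric]) auto
  \<comment> \<open>\<open>fl U\<close> reverses the signs of all blocks with index in
    \<open>U\<close>; it is an involution of \<open>Pow A\<close>.\<close>
  define fl where "fl U T = {i \<in> A. (i \<in> T) \<noteq> (\<beta> i \<in> U)}" for U T
  have rs: "rsum x A (fl U T) = rsum (\<lambda>j. rsum x (B j) T) {..<m} U" for U T
  proof -
    have "rsum x A (fl U T) = (\<Sum>j<m. \<Sum>i\<in>B j. rsign (fl U T) i *\<^sub>R x i)"
      unfolding rsum_def by (rule split)
    also have "\<dots> = (\<Sum>j<m. \<Sum>i\<in>B j. rsign U j *\<^sub>R rsign T i *\<^sub>R x i)"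
      by (intro sum.cong refl) (auto simp: B_def fl_def rsign_def)
    finally show ?thesis unfolding rsum_def by (simp add: scaleR_sum_right)
  qed
  let ?S = "\<Sum>T\<in>Pow A. (norm (rsum x A T))\<^sup>2"
  have flfl: "fl U (fl U T) = T" if "T \<subseteq> A" for U T using that unfolding fl_def by auto
  have fl_sub: "i \<in> fl U T \<Longrightarrow> i \<in> A" for i U T unfolding fl_def by simp
  have flip_sum: "?S = (\<Sum>T\<in>Pow A. (norm (rsum (\<lambda>j. rsum x (B j) T) {..<m} U))\<^sup>2)" for U
  proof -
    have "?S = (\<Sum>T\<in>Pow A. (norm (rsum x A (fl U T)))\<^sup>2)"
      by (rule sum.reindex_bij_witness[where i = "fl U" and j = "fl U"])
        (auto simp: flfl fl_sub)
    then show ?thesis unfolding rs .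
  qed
  \<comment> \<open>Averaging over \<open>U\<close> with \<open>T\<close> fixed applies
    \<open>b\<close> to the \<open>m\<close> block sums; averaging over \<open>T\<close> then
    applies \<open>c\<close> inside each block.\<close>
  have "2 ^ m * ?S = (\<Sum>U\<in>Pow {..<m}. ?S)" by (simp add: card_Pow)
  also have "\<dots> = (\<Sum>U\<in>Pow {..<m}. \<Sum>T\<in>Pow A. (norm (rsum (\<lambda>j. rsum x (B j) T) {..<m} U))\<^sup>2)"
    by (intro sum.cong refl flip_sum)
  also have "\<dots> = (\<Sum>T\<in>Pow A. \<Sum>U\<in>Pow {..<m}. (norm (rsum (\<lambda>j. rsum x (B j) T) {..<m} U))\<^sup>2)"
    by (rule sum.swap)
  also have "\<dots> \<le> (\<Sum>T\<in>Pow A. 2 ^ m * (b * real m * (\<Sum>j<m. (norm (rsum x (B j) T))\<^sup>2)))"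
    using rad_boundD[OF b(1), of "{..<m}"] by (intro sum_mono) simp
  also have "\<dots> = 2 ^ m * (b * real m * (\<Sum>T\<in>Pow A. \<Sum>j<m. (norm (rsum x (B j) T))\<^sup>2))"
    by (simp only: sum_distrib_left)
  also have "\<dots> = 2 ^ m * (b * real m * (\<Sum>j<m. \<Sum>T\<in>Pow A. (norm (rsum x (B j) T))\<^sup>2))"
    by (subst sum.swap) simp
  finally have "?S \<le> b * real m * (\<Sum>j<m. \<Sum>T\<in>Pow A. (norm (rsum x (B j) T))\<^sup>2)" by simp
  also have "\<dots> \<le> b * real m * (\<Sum>j<m. 2 ^ card A * (c * real n * (\<Sum>i\<in>B j. (norm (x i))\<^sup>2)))"
    using b(2) A card_B by (intro mult_left_mono sum_mono sum_Pow_rsum_le_of_rad_bound[OF c]) (auto simp: B_def)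
  also have "\<dots> = 2 ^ card A * (b * c * real (m * n) * (\<Sum>i\<in>A. (norm (x i))\<^sup>2))"
    unfolding split by (simp add: sum_distrib_left mult_ac)
  finally show "?S \<le> 2 ^ card A * (b * c * real (m * n) * (\<Sum>i\<in>A. (norm (x i))\<^sup>2))" .
qed

lemma rad_bound_power:
  assumes "rad_bound TYPE('a::real_normed_vector) b n" "0 \<le> b" "0 < n"
  shows "rad_bound TYPE('a) (b ^ k) (n ^ k)"
proof (induction k)
  case 0
  show ?case using rad_bound_1_1 by simp
next
  case (Suc k)
  then show ?case using rad_bound_mult[OF assms(1,2) Suc] assms(3) by simp
qed

section \<open>From a bound below 1 to a type above 1\<close>

lemma expectation_rademacher_pmf:
  fixes h :: "'a::real_normed_vector \<Rightarrow> real"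
  shows "measure_pmf.expectation (rademacher_pmf m) (\<lambda>\<epsilon>. h (\<Sum>i<m. \<epsilon> i *\<^sub>R x i))
    = (\<Sum>T\<in>Pow {..<m}. h (rsum x {..<m} T)) / 2 ^ m"
proof -
  let ?D = "PiE_dflt {..<m} (0::real) (\<lambda>_. {-1, 1})"
  have fin: "finite ?D" by (intro finite_PiE_dflt) auto
  have ne: "?D \<noteq> {}" by (auto simp: PiE_dflt_empty_iff)
  have card: "card ?D = 2 ^ m" by (subst card_PiE_dflt) (auto simp: numeral_2_eq_2)
  have "rademacher_pmf m = pmf_of_set ?D"
    unfolding rademacher_pmf_def by (intro Pi_pmf_of_set) auto
  then have "measure_pmf.expectation (rademacher_pmf m) (\<lambda>\<epsilon>. h (\<Sum>i<m. \<epsilon> i *\<^sub>R x i))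
      = (\<Sum>\<epsilon>\<in>?D. h (\<Sum>i<m. \<epsilon> i *\<^sub>R x i)) / 2 ^ m"
    using fin ne card by (simp add: integral_pmf_of_set)
  also have "(\<Sum>\<epsilon>\<in>?D. h (\<Sum>i<m. \<epsilon> i *\<^sub>R x i)) = (\<Sum>T\<in>Pow {..<m}. h (rsum x {..<m} T))"
  \<comment> \<open>Sign vectors take the default 0 outside \<open>{..<m}\<close>, hence the case
    distinction in the inverse map.\<close>
  proof (rule sum.reindex_bij_witness[where j = "\<lambda>\<epsilon>. {i. \<epsilon> i = -1}"
        and i = "\<lambda>T i. if i < m then rsign T i else 0"])
    fix \<epsilon> assume e: "\<epsilon> \<in> ?D"
    have v: "i < m \<Longrightarrow> \<epsilon> i = -1 \<or> \<epsilon> i = 1" "\<not> i < m \<Longrightarrow> \<epsilon> i = 0" for i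
      using e by (auto simp: PiE_dflt_def)
    show "(\<lambda>i. if i < m then rsign {i. \<epsilon> i = -1} i else 0) = \<epsilon>"
      using v by (force simp: rsign_def)
    show "{i. \<epsilon> i = -1} \<in> Pow {..<m}"
      using v(2) by (force simp: not_less[symmetric])
    show "h (rsum x {..<m} {i. \<epsilon> i = -1}) = h (\<Sum>i<m. \<epsilon> i *\<^sub>R x i)"
      unfolding rsum_def using v(1) by (intro arg_cong[where f = h] sum.cong) (auto simp: rsign_def)
  next
    fix T assume "T \<in> Pow {..<m}"
    then show "{i. (if i < m then rsign T i else 0) = -1} = T"
      by (auto simp: rsign_def split: if_splits)
    show "(\<lambda>i. if i < m then rsign T i else 0) \<in> ?D"
      by (auto simp: PiE_dflt_def rsign_def)
  qed
  finally show ?thesis .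
qed

text \<open>The index is the last one before \<open>R * u ^ k\<close> drops below
  \<open>s\<close>.\<close>

lemma geometric_bucket:
  fixes u s R :: real
  assumes "0 < u" "u < 1" "0 < s" "s \<le> R"
  shows "\<exists>k. R * u ^ Suc k < s \<and> s \<le> R * u ^ k"
proof -
  have R: "0 < R" using assms by simp
  obtain k where "u ^ k < s / R"
    using real_arch_pow_inv[of "s / R" u] assms R by auto
  then have k: "R * u ^ k < s" using R by (simp add: field_simps)
  have "\<not> R * u ^ 0 < s" using assms by simp
  then obtain j where "j < k" "\<forall>i\<le>j. \<not> R * u ^ i < s" "R * u ^ Suc j < s"
    using ex_least_nat_less[of "\<lambda>k. R * u ^ k < s" k] k by auto
  then show ?thesis by (intro exI[of _ j]) (simp add: not_less)
qed

text \<open>Vectors are grouped by the size of their norms on the scale \<open>u ^ k\<close> with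
  \<open>u powr p = 1 / N\<close>, so that the \<open>k\<close>-th group has at most \<open>N ^ (k + 1)\<close> members and contributes
  a term of order \<open>\<rho> ^ k\<close>.\<close>

lemma rad_bound_imp_sum_Pow_le:
  fixes x :: "nat \<Rightarrow> 'a::real_normed_vector"
  assumes b: "rad_bound TYPE('a) b N" "0 < b" and N: "2 \<le> N" and p: "1 < p"
    and u: "u = real N powr (- 1 / p)" and \<rho>: "\<rho> = sqrt b * real N * u" "\<rho> < 1"
    and A: "finite A" and R: "0 < R" "(\<Sum>i\<in>A. norm (x i) powr p) \<le> R powr p"
  shows "(\<Sum>T\<in>Pow A. (norm (rsum x A T))\<^sup>2) \<le> 2 ^ card A * (b * (real N)\<^sup>2 * R\<^sup>2 / (1 - \<rho>)\<^sup>2)"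
proof -
  have u0: "0 < u" unfolding u using N by simp
  have u1: "u < 1" unfolding u using N p by (simp add: powr_less_one)
  have up: "u powr p = 1 / real N"
    unfolding u using N p by (simp add: powr_powr powr_minus_divide powr_divide)
  have \<rho>0: "0 < \<rho>" unfolding \<rho> using b(2) N u0 by simp
  have norm_le: "norm (x i) \<le> R" if "i \<in> A" for i
  proof (rule ccontr)
    assume "\<not> norm (x i) \<le> R"
    then have "R powr p < norm (x i) powr p" using R p by (intro powr_less_mono2) auto
    also have "\<dots> \<le> (\<Sum>i\<in>A. norm (x i) powr p)" using that A by (intro member_le_sum) auto
    finally show False using R by simp
  qed
  \<comment> \<open>Zero vectors lie in no group and contribute nothing.\<close>
  define A' where "A' = {i \<in> A. x i \<noteq> 0}"
  have "\<exists>k. R * u ^ Suc k < norm (x i) \<and> norm (x i) \<le> R * u ^ k" if "i \<in> A'" for i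
    using geometric_bucket[OF u0 u1, of "norm (x i)" R] norm_le that unfolding A'_def by auto
  then obtain \<kappa> where \<kappa>: "\<And>i. i \<in> A' \<Longrightarrow> R * u ^ Suc (\<kappa> i) < norm (x i) \<and> norm (x i) \<le> R * u ^ \<kappa> i"
    by metis
  have "finite (\<kappa> ` A')" using A unfolding A'_def by simp
  then obtain K where K: "\<And>i. i \<in> A' \<Longrightarrow> \<kappa> i < K"
    by (metis finite_nat_set_iff_bounded imageI)
  define I where "I k = {i \<in> A'. \<kappa> i = k}" for k
  have I_sub: "I k \<subseteq> A" for k unfolding I_def A'_def by auto
  have finI: "finite (I k)" for k using I_sub A finite_subset by blast
  have split: "rsum x A T = (\<Sum>k<K. rsum x (I k) T)" for T
  proof -
    have "rsum x A T = (\<Sum>i\<in>A'. rsign T i *\<^sub>R x i)"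
      unfolding rsum_def A'_def using A by (intro sum.mono_neutral_right) auto
    also have "\<dots> = (\<Sum>k<K. \<Sum>i\<in>I k. rsign T i *\<^sub>R x i)"
      unfolding I_def using A K by (intro sum.group[symmetric]) (auto simp: A'_def)
    finally show ?thesis unfolding rsum_def .
  qed
  \<comment> \<open>Each member of group \<open>k\<close> contributes at least
    \<open>R powr p / N ^ Suc k\<close> to a sum that is at most \<open>R powr p\<close>.\<close>
  have card_I: "card (I k) \<le> N ^ Suc k" for k
  proof -
    have "real (card (I k)) * (R * u ^ Suc k) powr p = (\<Sum>i\<in>I k. (R * u ^ Suc k) powr p)" by simp
    also have "\<dots> \<le> (\<Sum>i\<in>I k. norm (x i) powr p)"
    proof (rule sum_mono)
      fix i assume "i \<in> I k"
      then have "R * u ^ Suc k \<le> norm (x i)" using \<kappa>[of i] unfolding I_def by auto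
      then show "(R * u ^ Suc k) powr p \<le> norm (x i) powr p"
        using p R u0 by (intro powr_mono2) auto
    qed
    also have "\<dots> \<le> (\<Sum>i\<in>A. norm (x i) powr p)" using A I_sub by (intro sum_mono2) auto
    also have "\<dots> \<le> R powr p" by (rule R)
    also have "(R * u ^ Suc k) powr p = R powr p * (u powr p) ^ Suc k"
      using R u0 by (simp only: powr_mult powr_power)
        (simp add: powr_realpow[symmetric] powr_powr mult.commute del: power_Suc)
    finally have "real (card (I k)) * (1 / real N) ^ Suc k * R powr p \<le> R powr p"
      unfolding up by (simp only: mult_ac)
    then have "real (card (I k)) * (1 / real N) ^ Suc k \<le> 1"
      using R(1) by (metis mult_le_cancel_right_pos mult_1 powr_gt_zero less_numeral_extra(3))
    then have "real (card (I k)) \<le> real N ^ Suc k"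
      using N by (simp add: field_simps power_divide del: power_Suc)
    then show ?thesis by (metis of_nat_le_iff of_nat_power)
  qed
  define C where "C = 2 ^ card A * (b * (real N)\<^sup>2 * R\<^sup>2)"
  have C0: "0 \<le> C" unfolding C_def using b(2) by simp
  have part: "(\<Sum>T\<in>Pow A. (norm (rsum x (I k) T))\<^sup>2) \<le> C * (\<rho> ^ k)\<^sup>2" for k
  proof -
    have rb: "rad_bound TYPE('a) (b ^ Suc k) (N ^ Suc k)"
      using b(2) N by (intro rad_bound_power[OF b(1)]) auto
    have "(\<Sum>i\<in>I k. (norm (x i))\<^sup>2) \<le> (\<Sum>i\<in>I k. (R * u ^ k)\<^sup>2)"
      using \<kappa> unfolding I_def by (intro sum_mono power_mono) auto
    also have "\<dots> = real (card (I k)) * (R * u ^ k)\<^sup>2" by simp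
    also have "\<dots> \<le> real (N ^ Suc k) * (R * u ^ k)\<^sup>2"
      using card_I by (intro mult_right_mono) (simp_all only: of_nat_le_iff zero_le_power2)
    finally have "b ^ Suc k * real (N ^ Suc k) * (\<Sum>i\<in>I k. (norm (x i))\<^sup>2)
        \<le> b ^ Suc k * real (N ^ Suc k) * (real (N ^ Suc k) * (R * u ^ k)\<^sup>2)"
      using b(2) by (intro mult_left_mono) auto
    also have "\<dots> = b * (real N)\<^sup>2 * R\<^sup>2 * (\<rho> ^ k)\<^sup>2"
    proof -
      have "(\<rho> ^ k)\<^sup>2 = (sqrt b * sqrt b) ^ k * (real N ^ k * real N ^ k) * (u ^ k)\<^sup>2"
        unfolding \<rho> by (simp only: power_mult_distrib power2_eq_square) (simp add: mult_ac power_mult_distrib)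
      also have "sqrt b * sqrt b = b" using b(2) by simp
      finally show ?thesis by (simp add: power2_eq_square mult_ac)
    qed
    finally have "2 ^ card A * (b ^ Suc k * real (N ^ Suc k) * (\<Sum>i\<in>I k. (norm (x i))\<^sup>2)) \<le> C * (\<rho> ^ k)\<^sup>2"
      unfolding C_def by simp
    then show ?thesis
      using sum_Pow_rsum_le_of_rad_bound[OF rb A I_sub[of k] card_I, of x] by linarith
  qed
  let ?g = "\<Sum>k<K. \<rho> ^ k"
  \<comment> \<open>Cauchy-Schwarz with weights \<open>\<rho> ^ k\<close>: the group bounds
    \<open>C * (\<rho> ^ k)\<^sup>2\<close>, divided by the weights, still form a geometric
    series.\<close>
  have pointwise: "(norm (rsum x A T))\<^sup>2 \<le> ?g * (\<Sum>k<K. (norm (rsum x (I k) T))\<^sup>2 / \<rho> ^ k)" for T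
  proof -
    have "(norm (rsum x A T))\<^sup>2 \<le> (\<Sum>k<K. norm (rsum x (I k) T))\<^sup>2"
      unfolding split by (intro power_mono norm_sum norm_ge_zero)
    also have "(\<Sum>k<K. norm (rsum x (I k) T))
        = (\<Sum>k<K. sqrt (\<rho> ^ k) * (norm (rsum x (I k) T) / sqrt (\<rho> ^ k)))"
      using \<rho>0 by (intro sum.cong) auto
    also have "\<dots>\<^sup>2 \<le> (\<Sum>k<K. (sqrt (\<rho> ^ k))\<^sup>2) * (\<Sum>k<K. (norm (rsum x (I k) T) / sqrt (\<rho> ^ k))\<^sup>2)"
      by (rule Cauchy_Schwarz_ineq_sum)
    also have "\<dots> = ?g * (\<Sum>k<K. (norm (rsum x (I k) T))\<^sup>2 / \<rho> ^ k)"
      using \<rho>0 by (simp add: power_divide)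
    finally show ?thesis .
  qed
  have g0: "0 \<le> ?g" using \<rho>0 by (intro sum_nonneg) simp
  have g1: "?g \<le> 1 / (1 - \<rho>)"
  proof -
    have "(1 - \<rho>) * ?g \<le> 1" using one_diff_power_eq[of \<rho> K] zero_le_power[of \<rho> K] \<rho>0 by linarith
    then show ?thesis using \<rho>(2) by (simp add: field_simps)
  qed
  have "(\<Sum>T\<in>Pow A. (norm (rsum x A T))\<^sup>2)
      \<le> (\<Sum>T\<in>Pow A. ?g * (\<Sum>k<K. (norm (rsum x (I k) T))\<^sup>2 / \<rho> ^ k))"
    by (intro sum_mono pointwise)
  also have "\<dots> = ?g * (\<Sum>k<K. (\<Sum>T\<in>Pow A. (norm (rsum x (I k) T))\<^sup>2) / \<rho> ^ k)"
    unfolding sum_distrib_left[symmetric] sum_divide_distrib by (subst sum.swap) (rule refl)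
  also have "\<dots> \<le> ?g * (\<Sum>k<K. C * (\<rho> ^ k)\<^sup>2 / \<rho> ^ k)"
    using g0 \<rho>0 part by (intro mult_left_mono sum_mono divide_right_mono) auto
  also have "\<dots> = C * ?g\<^sup>2"
    using \<rho>0 by (simp add: power2_eq_square sum_distrib_left[symmetric] mult_ac)
  also have "\<dots> \<le> C * (1 / (1 - \<rho>))\<^sup>2"
    using C0 g0 g1 by (intro mult_left_mono power_mono) auto
  also have "\<dots> = 2 ^ card A * (b * (real N)\<^sup>2 * R\<^sup>2 / (1 - \<rho>)\<^sup>2)"
    unfolding C_def by (simp add: power_divide)
  finally show ?thesis .
qed

text \<open>This turns second moments into \<open>p\<close>-th moments. The first term suffices for
  \<open>t \<le> R\<close>; beyond \<open>R\<close> the factor \<open>t powr (p - 2)\<close> has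
  become smaller than at \<open>R\<close>, or at most equal.\<close>

lemma powr_le_add_square:
  fixes t R p :: real
  assumes "0 \<le> t" "0 < R" "1 < p" "p \<le> 2"
  shows "t powr p \<le> R powr p + R powr (p - 2) * t\<^sup>2"
proof (cases "t \<le> R")
  case True
  then have "t powr p \<le> R powr p" using assms by (intro powr_mono2) auto
  then show ?thesis by (rule order_trans) simp
next
  case False
  then have t: "0 < t" "R \<le> t" using assms by auto
  have "t powr p = t powr (p - 2) * t\<^sup>2"
    using t by (simp add: powr_diff)
  also have "\<dots> \<le> R powr (p - 2) * t\<^sup>2"
    using t assms by (intro mult_right_mono powr_mono2') auto
  finally show ?thesis by (rule order_trans) simp
qed

text \<open>At \<open>p = 1\<close> the ratio \<open>\<rho>\<close> of the geometric series equals
  \<open>sqrt b < 1\<close>; by continuity it stays below 1 for some \<open>p > 1\<close>, and the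
  grouping argument applies.\<close>

lemma rad_bound_imp_has_rademacher_type:
  assumes b: "rad_bound TYPE('a::real_normed_vector) b N" "0 < b" "b < 1" and N: "2 \<le> N"
  shows "\<exists>p. 1 < p \<and> p \<le> 2 \<and> has_rademacher_type TYPE('a) p"
proof -
  let ?\<rho> = "\<lambda>p. sqrt b * real N * real N powr (- 1 / p)"
  have "(?\<rho> \<longlongrightarrow> ?\<rho> 1) (at_right 1)"
    using N by (intro tendsto_intros) auto
  moreover have "?\<rho> 1 < 1" using N b by (simp add: powr_minus_divide)
  ultimately have "\<forall>\<^sub>F p in at_right 1. ?\<rho> p < 1" by (rule order_tendstoD(2))
  moreover have "\<forall>\<^sub>F p in at_right (1::real). 1 < p \<and> p < 2"
    by (rule eventually_at_right_real[of 1 2, simplified])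
  ultimately have "\<forall>\<^sub>F p in at_right 1. ?\<rho> p < 1 \<and> 1 < p \<and> p < 2"
    by eventually_elim simp
  then obtain p where \<rho>: "?\<rho> p < 1" and p: "1 < p" "p < 2"
    using eventually_happens[of _ "at_right (1::real)"] by (auto simp: trivial_limit_at_right_real)
  define K where "K = b * (real N)\<^sup>2 / (1 - ?\<rho> p)\<^sup>2"
  have K0: "0 \<le> K" unfolding K_def using b by simp
  have "(measure_pmf.expectation (rademacher_pmf m)
           (\<lambda>\<epsilon>. norm (\<Sum>i<m. \<epsilon> i *\<^sub>R x i) powr p)) powr (1 / p)
        \<le> (1 + K) powr (1 / p) * (\<Sum>i<m. norm (x i) powr p) powr (1 / p)" for m and x :: "nat \<Rightarrow> 'a"
  proof -
    let ?E = "(\<Sum>T\<in>Pow {..<m}. norm (rsum x {..<m} T) powr p) / 2 ^ m"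
    define s where "s = (\<Sum>i<m. norm (x i) powr p)"
    have s0: "0 \<le> s" unfolding s_def by (intro sum_nonneg) simp
    have "?E \<le> (1 + K) * s"
    proof (cases "s = 0")
      case True
      then have "\<forall>i<m. x i = 0"
        unfolding s_def by (subst (asm) sum_nonneg_eq_0_iff) auto
      then have "rsum x {..<m} T = 0" for T unfolding rsum_def by simp
      then show ?thesis using True by simp
    next
      case False
      \<comment> \<open>With \<open>R\<close> the \<open>p\<close>-norm of the vectors' norms, the
        second moment is at most \<open>K * R\<^sup>2\<close>.\<close>
      define R where "R = s powr (1 / p)"
      have R0: "0 < R" unfolding R_def using False s0 by simp
      have Rp: "R powr p = s" unfolding R_def using False s0 p by (simp add: powr_powr)
      have "(\<Sum>T\<in>Pow {..<m}. norm (rsum x {..<m} T) powr p)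
          \<le> (\<Sum>T\<in>Pow {..<m}. R powr p + R powr (p - 2) * (norm (rsum x {..<m} T))\<^sup>2)"
        using R0 p by (intro sum_mono powr_le_add_square) auto
      also have "\<dots> = 2 ^ m * R powr p + R powr (p - 2) * (\<Sum>T\<in>Pow {..<m}. (norm (rsum x {..<m} T))\<^sup>2)"
        by (simp add: sum.distrib sum_distrib_left card_Pow)
      also have "\<dots> \<le> 2 ^ m * R powr p + R powr (p - 2) * (2 ^ m * (K * R\<^sup>2))"
        using rad_bound_imp_sum_Pow_le[OF b(1,2) N p(1) refl refl \<rho>, of "{..<m}" R x] R0 Rp
        unfolding K_def s_def by (intro add_left_mono mult_left_mono) (simp_all add: mult_ac)
      also have "\<dots> = 2 ^ m * ((1 + K) * R powr p)"
      proof -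
        have "R powr (p - 2) * R\<^sup>2 = R powr p" using R0 by (simp add: powr_diff)
        then have "R powr (p - 2) * (2 ^ m * (K * R\<^sup>2)) = 2 ^ m * K * R powr p"
          by (simp add: mult_ac)
        then show ?thesis by (simp add: algebra_simps)
      qed
      finally show ?thesis unfolding Rp by (simp add: field_simps)
    qed
    then have "?E powr (1 / p) \<le> ((1 + K) * s) powr (1 / p)"
      using p by (intro powr_mono2) (auto intro!: divide_nonneg_nonneg sum_nonneg)
    also have "\<dots> = (1 + K) powr (1 / p) * s powr (1 / p)"
      using K0 s0 by (simp add: powr_mult)
    finally show ?thesis
      unfolding s_def using expectation_rademacher_pmf[of m "\<lambda>v. norm v powr p" x] by simp
  qed
  then have "has_rademacher_type TYPE('a) p" unfolding has_rademacher_type_def by blast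
  then show ?thesis using p by (intro exI[of _ p]) simp
qed

lemma trivial_type_imp_not_rad_bound:
  assumes "trivial_type TYPE('a::real_normed_vector)" "2 \<le> n" "0 < b" "b < 1"
  shows "\<not> rad_bound TYPE('a) b n"
proof
  assume "rad_bound TYPE('a) b n"
  then obtain p where p: "1 < p" "p \<le> 2" "has_rademacher_type TYPE('a) p"
    using rad_bound_imp_has_rademacher_type assms by blast
  have "p \<le> Sup {p \<in> {1..2}. has_rademacher_type TYPE('a) p}"
    using p by (intro cSup_upper) (auto intro!: bdd_aboveI[of _ 2])
  then show False using assms(1) p(1) unfolding trivial_type_def by simp
qed

section \<open>Almost isometric copies of finite-dimensional l1\<close>

text \<open>If the type-2 inequality for \<open>n\<close> vectors nearly fails to improve on the triangle inequality,
  then the extremal vectors have almost equal norms and all their signed sums almost attain the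
  triangle inequality.\<close>

lemma not_rad_bound_imp_almost_isometric_l1:
  assumes no: "\<And>b. 0 < b \<Longrightarrow> b < 1 \<Longrightarrow> \<not> rad_bound TYPE('a::real_normed_vector) b n"
    and n: "2 \<le> n" and c: "0 < c" "c < 1"
  shows "\<exists>y :: nat \<Rightarrow> 'a. (\<forall>i<n. norm (y i) \<le> 1) \<and>
    (\<forall>a. c * (\<Sum>i<n. \<bar>a i\<bar>) \<le> norm (\<Sum>i<n. a i *\<^sub>R y i))"
proof -
  \<comment> \<open>\<open>\<kappa>\<close> is the relative error allowed for norms and signed sums,
    chosen to give \<open>1 - 2 * n * \<kappa> = c + \<kappa>\<close>. \<open>\<eta>\<close> is so
    small that even a defect concentrated on one of the \<open>2 ^ n\<close> sign choices stays
    below \<open>\<kappa>\<close>.\<close>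
  define \<kappa> where "\<kappa> = (1 - c) / (2 * real n + 1)"
  define \<eta> where "\<eta> = \<kappa>\<^sup>2 / 2 ^ Suc n"
  have \<kappa>0: "0 < \<kappa>" and \<kappa>1: "\<kappa> < 1" unfolding \<kappa>_def using c by (auto simp: field_simps)
  have \<kappa>c: "1 - 2 * real n * \<kappa> = c + \<kappa>"
    unfolding \<kappa>_def by (simp add: field_simps)
  have \<eta>0: "0 < \<eta>" unfolding \<eta>_def using \<kappa>0 by simp
  have \<kappa>2: "\<kappa>\<^sup>2 \<le> \<kappa>" using \<kappa>0 \<kappa>1 by (simp add: power2_eq_square mult_left_le)
  have e2: "2 * (2 ^ n * \<eta>) = \<kappa>\<^sup>2" unfolding \<eta>_def by simp
  have "real n < 2 ^ n" by (metis of_nat_less_two_power)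
  then have "real n * \<eta> \<le> 2 ^ n * \<eta>" using \<eta>0 by (intro mult_right_mono) auto
  then have ne: "2 * (real n * \<eta>) \<le> \<kappa>\<^sup>2" using e2 by linarith
  then have ne1: "real n * \<eta> < 1" using \<kappa>2 \<kappa>1 by linarith
  have "\<eta> \<le> real n * \<eta>" using n \<eta>0 by simp
  then have \<eta>1: "\<eta> < 1" using ne1 by linarith
  obtain A :: "nat set" and x :: "nat \<Rightarrow> 'a" where A: "finite A" "card A \<le> n"
    and big: "2 ^ card A * ((1 - \<eta>) * real n * (\<Sum>i\<in>A. (norm (x i))\<^sup>2)) < (\<Sum>T\<in>Pow A. (norm (rsum x A T))\<^sup>2)"
    using no[of "1 - \<eta>"] \<eta>0 \<eta>1 unfolding rad_bound_def by (auto simp: not_le)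
  define Q where "Q = (\<Sum>i\<in>A. (norm (x i))\<^sup>2)"
  define L where "L = (\<Sum>i\<in>A. norm (x i))"
  have Q0: "0 \<le> Q" unfolding Q_def by (intro sum_nonneg) simp
  have L0: "0 \<le> L" unfolding L_def by (intro sum_nonneg) simp
  have rL: "(norm (rsum x A T))\<^sup>2 \<le> L\<^sup>2" for T
    unfolding L_def by (intro power_mono norm_rsum_le norm_ge_zero)
  have LQ: "L\<^sup>2 \<le> Q * real (card A)"
    unfolding L_def Q_def by (rule sum_squared_le_sum_of_squares)
  also have "\<dots> \<le> Q * real n" using A Q0 by (intro mult_left_mono) auto
  finally have LnQ: "L\<^sup>2 \<le> real n * Q" by (simp add: mult.commute)
  have "(\<Sum>T\<in>Pow A. (norm (rsum x A T))\<^sup>2) \<le> (\<Sum>T\<in>Pow A. L\<^sup>2)" by (intro sum_mono rL)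
  also have "\<dots> = 2 ^ card A * L\<^sup>2" using A by (simp add: card_Pow)
  finally have "2 ^ card A * ((1 - \<eta>) * real n * Q) < 2 ^ card A * L\<^sup>2"
    using big unfolding Q_def by linarith
  then have Llow: "(1 - \<eta>) * real n * Q < L\<^sup>2" by simp
  have Qpos: "0 < Q"
  proof (rule ccontr)
    assume "\<not> 0 < Q"
    then have "Q = 0" using Q0 by simp
    then show False using Llow LQ by simp
  qed
  \<comment> \<open>Fewer than \<open>n\<close> vectors would lose a factor of at least
    \<open>1 / n\<close> in Cauchy-Schwarz, more than \<open>\<eta>\<close> allows.\<close>
  have "(1 - \<eta>) * real n * Q < real (card A) * Q" using Llow LQ by (simp add: mult.commute)
  then have "(1 - \<eta>) * real n < real (card A)" using Qpos by simp
  then have "real n - real n * \<eta> < real (card A)" by (simp add: algebra_simps)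
  then have cardA: "card A = n" using ne1 A(2) by linarith
  \<comment> \<open>The quadratic mean of the norms.\<close>
  define r where "r = sqrt (Q / real n)"
  have r0: "0 < r" unfolding r_def using Qpos n by simp
  have Qr: "Q = real n * r\<^sup>2" unfolding r_def using Qpos n by simp
  \<comment> \<open>No squared signed sum exceeds \<open>n * Q\<close>, while their average exceeds
    \<open>(1 - \<eta>) * n * Q\<close>; so each falls short by less than
    \<open>2 ^ n * \<eta> * n * Q\<close>.\<close>
  have signs: "real n * r * (1 - \<kappa>) \<le> norm (rsum x A T)" if T: "T \<subseteq> A" for T
  proof -
    have "(\<Sum>T\<in>Pow A. (norm (rsum x A T))\<^sup>2)
        = (norm (rsum x A T))\<^sup>2 + (\<Sum>T\<in>Pow A - {T}. (norm (rsum x A T))\<^sup>2)"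
      using A T by (intro sum.remove) auto
    also have "(\<Sum>T\<in>Pow A - {T}. (norm (rsum x A T))\<^sup>2) \<le> (\<Sum>T\<in>Pow A - {T}. real n * Q)"
      using rL LnQ by (intro sum_mono) (rule order_trans)
    also have "\<dots> = (2 ^ n - 1) * (real n * Q)"
      using A T cardA by (simp add: card_Diff_subset card_Pow of_nat_diff)
    finally have "2 ^ n * ((1 - \<eta>) * real n * Q) < (norm (rsum x A T))\<^sup>2 + (2 ^ n - 1) * (real n * Q)"
      using big cardA unfolding Q_def by simp
    then have "(1 - 2 ^ n * \<eta>) * (real n * Q) < (norm (rsum x A T))\<^sup>2"
      by (simp add: algebra_simps)
    moreover have "(1 - \<kappa>)\<^sup>2 * (real n * Q) \<le> (1 - 2 ^ n * \<eta>) * (real n * Q)"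
    proof (rule mult_right_mono)
      have "(1 - \<kappa>)\<^sup>2 \<le> 1 - \<kappa>" using \<kappa>0 \<kappa>1 by (simp add: power2_eq_square mult_left_le)
      moreover have "2 ^ n * \<eta> \<le> \<kappa>" using e2 \<kappa>2 \<kappa>0 by linarith
      ultimately show "(1 - \<kappa>)\<^sup>2 \<le> 1 - 2 ^ n * \<eta>" by linarith
    qed (use Q0 in simp)
    moreover have "(1 - \<kappa>)\<^sup>2 * (real n * Q) = (real n * r * (1 - \<kappa>))\<^sup>2"
      unfolding Qr by (simp add: power2_eq_square)
    ultimately have "(real n * r * (1 - \<kappa>))\<^sup>2 \<le> (norm (rsum x A T))\<^sup>2" by linarith
    then show ?thesis by (rule power2_le_imp_le) simp
  qed
  have Lr: "real n * r * (1 - \<eta>) \<le> L"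
  proof (rule power2_le_imp_le[OF _ L0])
    have "(real n * r * (1 - \<eta>))\<^sup>2 = (1 - \<eta>) * ((1 - \<eta>) * real n * Q)"
      unfolding Qr by (simp add: power2_eq_square)
    also have "\<dots> \<le> (1 - \<eta>) * real n * Q"
      using \<eta>0 \<eta>1 Q0 by (intro mult_left_le_one_le) auto
    finally show "(real n * r * (1 - \<eta>))\<^sup>2 \<le> L\<^sup>2" using Llow by linarith
  qed
  \<comment> \<open>The sum \<open>L\<close> of the norms nearly attains \<open>n * r\<close>, so
    the norms have a small variance around \<open>r\<close>.\<close>
  have norms: "norm (x i) \<le> r * (1 + \<kappa>)" if i: "i \<in> A" for i
  proof -
    have "(norm (x i) - r)\<^sup>2 \<le> (\<Sum>j\<in>A. (norm (x j) - r)\<^sup>2)"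
      using A i by (intro member_le_sum) auto
    also have "\<dots> = (\<Sum>j\<in>A. (norm (x j))\<^sup>2 - 2 * r * norm (x j) + r\<^sup>2)"
      by (intro sum.cong) (auto simp: power2_eq_square algebra_simps)
    also have "\<dots> = Q - 2 * r * L + real n * r\<^sup>2"
      unfolding Q_def L_def using cardA by (simp add: sum.distrib sum_subtractf sum_distrib_left)
    also have "\<dots> \<le> real n * r\<^sup>2 - 2 * r * (real n * r * (1 - \<eta>)) + real n * r\<^sup>2"
      using mult_left_mono[OF Lr, of "2 * r"] r0 unfolding Qr by simp
    also have "\<dots> = 2 * (real n * \<eta>) * r\<^sup>2" by (simp add: power2_eq_square algebra_simps)
    also have "\<dots> \<le> \<kappa>\<^sup>2 * r\<^sup>2" using ne by (intro mult_right_mono) auto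
    finally have "(norm (x i) - r)\<^sup>2 \<le> (\<kappa> * r)\<^sup>2" by (simp add: power_mult_distrib)
    then have "norm (x i) - r \<le> \<kappa> * r" by (rule power2_le_imp_le) (use \<kappa>0 r0 in simp)
    then show ?thesis by (simp add: algebra_simps)
  qed
  obtain h where h: "bij_betw h {..<n} A"
    using ex_bij_betw_nat_finite[OF A(1)] cardA by (metis atLeast0LessThan)
  have hA: "h i \<in> A" if "i < n" for i using h that by (auto simp: bij_betw_def)
  define s where "s = r * (1 + \<kappa>)"
  have s0: "0 < s" unfolding s_def using r0 \<kappa>0 by simp
  define y where "y i = x (h i) /\<^sub>R s" for i
  have "norm (y i) \<le> 1" if "i < n" for i
    using norms[OF hA[OF that]] s0 unfolding y_def s_def[symmetric] by (simp add: field_simps)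
  moreover have "c * (\<Sum>i<n. \<bar>a i\<bar>) \<le> norm (\<Sum>i<n. a i *\<^sub>R y i)" for a
  proof -
    define S where "S = (\<Sum>i<n. \<bar>a i\<bar>)"
    define z where "z = (\<Sum>i<n. a i *\<^sub>R x (h i))"
    \<comment> \<open>With the signs of \<open>a\<close>, the vector
      \<open>S *\<^sub>R rsum x A T\<close> is \<open>z\<close> plus a remainder with nonnegative
      weights \<open>S - \<bar>a i\<bar>\<close>. The remainder is bounded by the triangle
      inequality, so the lower bound on signed sums passes to \<open>z\<close>.\<close>
    define T where "T = h ` {i. i < n \<and> a i < 0}"
    have S0: "0 \<le> S" unfolding S_def by (intro sum_nonneg) simp
    have TA: "T \<subseteq> A" unfolding T_def using hA by auto
    have inT: "h i \<in> T \<longleftrightarrow> a i < 0" if "i < n" for i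
      using that h unfolding T_def bij_betw_def inj_on_def by auto
    have sg: "rsign T (h i) * \<bar>a i\<bar> = a i" if "i < n" for i
      using inT[OF that] unfolding rsign_def by auto
    have "rsum x A T = (\<Sum>i<n. rsign T (h i) *\<^sub>R x (h i))"
      unfolding rsum_def by (rule sum.reindex_bij_betw[OF h, symmetric])
    then have "S *\<^sub>R rsum x A T = (\<Sum>i<n. (S * rsign T (h i)) *\<^sub>R x (h i))"
      by (simp add: scaleR_sum_right)
    also have "\<dots> = (\<Sum>i<n. a i *\<^sub>R x (h i) + ((S - \<bar>a i\<bar>) * rsign T (h i)) *\<^sub>R x (h i))"
    proof (intro sum.cong refl)
      fix i assume "i \<in> {..<n}"
      then have "S * rsign T (h i) = a i + (S - \<bar>a i\<bar>) * rsign T (h i)"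
        using sg[of i] by (simp add: algebra_simps)
      then show "(S * rsign T (h i)) *\<^sub>R x (h i) = a i *\<^sub>R x (h i) + ((S - \<bar>a i\<bar>) * rsign T (h i)) *\<^sub>R x (h i)"
        by (simp only: scaleR_add_left)
    qed
    also have "\<dots> = z + (\<Sum>i<n. ((S - \<bar>a i\<bar>) * rsign T (h i)) *\<^sub>R x (h i))"
      unfolding z_def by (rule sum.distrib)
    finally have "S * norm (rsum x A T) \<le> norm z + norm (\<Sum>i<n. ((S - \<bar>a i\<bar>) * rsign T (h i)) *\<^sub>R x (h i))"
      using S0 by (metis abs_of_nonneg norm_scaleR norm_triangle_ineq)
    also have "norm (\<Sum>i<n. ((S - \<bar>a i\<bar>) * rsign T (h i)) *\<^sub>R x (h i)) \<le> (\<Sum>i<n. (S - \<bar>a i\<bar>) * s)"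
    proof (rule sum_norm_le)
      fix i assume i: "i \<in> {..<n}"
      have "\<bar>a i\<bar> \<le> S" unfolding S_def using i by (intro member_le_sum) auto
      then show "norm (((S - \<bar>a i\<bar>) * rsign T (h i)) *\<^sub>R x (h i)) \<le> (S - \<bar>a i\<bar>) * s"
        using norms[OF hA, of i] i unfolding s_def
        by (auto simp: rsign_def abs_mult intro!: mult_left_mono)
    qed
    also have "\<dots> = (real n * S - S) * s"
      unfolding S_def by (simp add: sum_distrib_right[symmetric] sum_subtractf)
    finally have "S * norm (rsum x A T) \<le> norm z + (real n * S - S) * s" by simp
    moreover have "S * (real n * r * (1 - \<kappa>)) \<le> S * norm (rsum x A T)"
      using signs[OF TA] S0 by (intro mult_left_mono)
    ultimately have "S * (real n * r * (1 - \<kappa>)) - (real n * S - S) * s \<le> norm z" by linarith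
    moreover have "S * (real n * r * (1 - \<kappa>)) - (real n * S - S) * s = S * r * (\<kappa> + (1 - 2 * real n * \<kappa>))"
      unfolding s_def by (simp add: algebra_simps)
    moreover have "S * r * (c * (1 + \<kappa>)) \<le> S * r * (\<kappa> + (1 - 2 * real n * \<kappa>))"
    proof (rule mult_left_mono)
      have "c * \<kappa> \<le> \<kappa>" using c \<kappa>0 by simp
      then show "c * (1 + \<kappa>) \<le> \<kappa> + (1 - 2 * real n * \<kappa>)"
        unfolding \<kappa>c using \<kappa>0 by (simp add: algebra_simps)
    qed (use S0 r0 in simp)
    ultimately have "c * S * s \<le> norm z" unfolding s_def by (simp add: mult_ac)
    moreover have "(\<Sum>i<n. a i *\<^sub>R y i) = z /\<^sub>R s"
      unfolding z_def y_def by (simp add: scaleR_sum_right mult.commute)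
    ultimately show ?thesis unfolding S_def[symmetric] using s0 by (simp add: field_simps)
  qed
  ultimately show ?thesis by blast
qed

section \<open>Weak nets\<close>

text \<open>Any net misses the hull of some \<open>k\<close>-subset of the \<open>y i\<close> by at
  least \<open>c\<close>, and the diameter is at most 2.\<close>

lemma weak_net_ge_of_l1:
  fixes y :: "nat \<Rightarrow> 'a::real_normed_vector"
  assumes k: "0 < k" "\<epsilon> * real n \<le> real k" and n: "M + 2 * k \<le> n + 1" and c: "0 < c"
    and y: "\<And>i. i < n \<Longrightarrow> norm (y i) \<le> 1"
    and l1: "\<And>a. c * (\<Sum>i<n. \<bar>a i\<bar>) \<le> norm (\<Sum>i<n. a i *\<^sub>R y i)"
    and n2: "2 \<le> n"
  shows "ennreal (c / 2) \<le> weak_net TYPE('a) \<epsilon> M"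
proof -
  define P where "P = y ` {..<n}"
  have inj: "inj_on y {..<n}"
  proof (rule inj_onI, rule ccontr)
    fix i j assume ij: "i \<in> {..<n}" "j \<in> {..<n}" "y i = y j" "i \<noteq> j"
    define a where "a l = (if l = i then 1 else if l = j then -1 else 0 :: real)" for l
    have "(\<Sum>l<n. a l *\<^sub>R y l) = (\<Sum>l\<in>{i, j}. a l *\<^sub>R y l)"
      using ij by (intro sum.mono_neutral_right) (auto simp: a_def)
    then have "(\<Sum>l<n. a l *\<^sub>R y l) = 0" using ij by (simp add: a_def)
    moreover have "\<bar>a i\<bar> \<le> (\<Sum>l<n. \<bar>a l\<bar>)" using ij by (intro member_le_sum) auto
    ultimately have "c * 1 \<le> 0" using l1[of a] c
      by (metis abs_one a_def mult_le_cancel_left_pos norm_zero order_trans)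
    then show False using c by simp
  qed
  \<comment> \<open>The difference of two convex combinations with disjoint supports has
    coefficients of l1 norm 2.\<close>
  have sep: "2 * c \<le> norm (u - v)"
    if YZ: "Y \<subseteq> {..<n}" "Z \<subseteq> {..<n}" "Y \<inter> Z = {}" and u: "u \<in> convex hull (y ` Y)"
      and v: "v \<in> convex hull (y ` Z)" for Y Z u v
  proof -
    have coeffs: "\<exists>w. (\<forall>i\<in>Y. 0 \<le> w i) \<and> sum w Y = 1 \<and> (\<Sum>i\<in>Y. w i *\<^sub>R y i) = u"
      if Y: "Y \<subseteq> {..<n}" and u: "u \<in> convex hull (y ` Y)" for Y u
    proof -
      have fin: "finite (y ` Y)" and injY: "inj_on y Y"
        using Y inj finite_subset by (auto intro: inj_on_subset)
      obtain w where "\<forall>x\<in>y ` Y. 0 \<le> w x" "sum w (y ` Y) = 1" "(\<Sum>x\<in>y ` Y. w x *\<^sub>R x) = u"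
        using u unfolding convex_hull_finite[OF fin] by blast
      then show ?thesis
        by (intro exI[of _ "w \<circ> y"]) (simp add: sum.reindex[OF injY])
    qed
    obtain w where w: "\<And>i. i \<in> Y \<Longrightarrow> 0 \<le> w i" "sum w Y = 1" "(\<Sum>i\<in>Y. w i *\<^sub>R y i) = u"
      using coeffs[OF YZ(1) u] by auto
    obtain w' where w': "\<And>i. i \<in> Z \<Longrightarrow> 0 \<le> w' i" "sum w' Z = 1" "(\<Sum>i\<in>Z. w' i *\<^sub>R y i) = v"
      using coeffs[OF YZ(2) v] by auto
    define a where "a i = (if i \<in> Y then w i else 0) - (if i \<in> Z then w' i else 0)" for i
    have restr: "(\<Sum>i<n. if i \<in> B then g i else 0) = sum g B" if "B \<subseteq> {..<n}"
      for B and g :: "nat \<Rightarrow> 'b::comm_monoid_add"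
      using that by (simp add: sum.inter_restrict[symmetric] Int_absorb1)
    have "(\<Sum>i<n. a i *\<^sub>R y i) = (\<Sum>i<n. (if i \<in> Y then w i *\<^sub>R y i else 0) - (if i \<in> Z then w' i *\<^sub>R y i else 0))"
      by (intro sum.cong) (auto simp: a_def scaleR_diff_left)
    also have "\<dots> = u - v"
      using w(3) w'(3) by (simp add: sum_subtractf restr[OF YZ(1)] restr[OF YZ(2)])
    finally have uv: "(\<Sum>i<n. a i *\<^sub>R y i) = u - v" .
    have "(\<Sum>i<n. \<bar>a i\<bar>) = (\<Sum>i<n. (if i \<in> Y then w i else 0) + (if i \<in> Z then w' i else 0))"
      using w(1) w'(1) YZ(3) by (intro sum.cong) (auto simp: a_def)
    also have "\<dots> = 2"
      using w(2) w'(2) by (simp add: sum.distrib restr[OF YZ(1)] restr[OF YZ(2)])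
    finally show ?thesis using l1[of a] uv by simp
  qed
  have sep2: "2 * c \<le> norm (y i - y j)" if "i < n" "j < n" "i \<noteq> j" for i j
    using sep[of "{i}" "{j}" "y i" "y j"] that by (simp add: hull_inc)
  have finP: "finite P" and cardP: "card P = n"
    unfolding P_def using inj by (simp_all add: card_image)
  have diam2: "diameter P \<le> 2"
  proof (rule diameter_le)
    fix p q assume "p \<in> P" "q \<in> P"
    then have "norm p \<le> 1" "norm q \<le> 1" unfolding P_def using y by auto
    then show "norm (p - q) \<le> 2" using norm_triangle_ineq4[of p q] by linarith
  qed simp
  have diam0: "0 < diameter P"
  proof -
    have "dist (y 0) (y 1) \<le> diameter P"
      using n2 finP by (intro diameter_bounded_bound finite_imp_bounded) (auto simp: P_def)
    then show ?thesis using sep2[of 0 1] n2 c by (simp add: dist_norm)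
  qed
  have far: "\<exists>Y. Y \<subseteq> P \<and> \<epsilon> * real (card P) \<le> real (card Y) \<and> ennreal c \<le> eset_dist F (convex hull Y)"
    if F: "finite F" "card F \<le> M" for F
  proof (rule ccontr)
    assume neg: "\<not> ?thesis"
    have near: "\<exists>f\<in>F. \<exists>u\<in>convex hull (y ` Y). norm (f - u) < c" if Y: "Y \<subseteq> {..<n}" "card Y = k" for Y
    proof -
      have "card (y ` Y) = card Y" using inj Y(1) by (intro card_image) (rule inj_on_subset)
      then have "\<epsilon> * real (card P) \<le> real (card (y ` Y))" using k(2) cardP Y(2) by simp
      moreover have "y ` Y \<subseteq> P" unfolding P_def using Y(1) by (rule image_mono)
      ultimately have "\<not> ennreal c \<le> eset_dist F (convex hull (y ` Y))" using neg by blast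
      then obtain f u where "f \<in> F" "u \<in> convex hull (y ` Y)" "ennreal (norm (f - u)) < ennreal c"
        unfolding eset_dist_def not_le INF_less_iff by blast
      then show ?thesis using c by (auto simp: ennreal_less_iff)
    qed
    obtain e where e: "bij_betw e F {..<card F}"
      using ex_bij_betw_finite_nat[OF F(1)] by (metis atLeast0LessThan)
    \<comment> \<open>The colour of \<open>Y\<close> is the index under \<open>e\<close> of a net
      point close to its hull.\<close>
    define f where "f Y = (SOME f. f \<in> F \<and> (\<exists>u\<in>convex hull (y ` Y). norm (f - u) < c))" for Y
    have f: "f Y \<in> F \<and> (\<exists>u\<in>convex hull (y ` Y). norm (f Y - u) < c)" if "Y \<subseteq> {..<n}" "card Y = k" for Y
      unfolding f_def by (rule someI_ex) (use near[OF that] in blast)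
    have "e (f Y) < M" if "Y \<subseteq> {..<n}" "card Y = k" for Y
      using bij_betw_apply[OF e] f[OF that] F(2) by force
    then obtain Y Z where YZ: "Y \<subseteq> {..<n}" "Z \<subseteq> {..<n}" "card Y = k" "card Z = k" "Y \<inter> Z = {}"
      and same: "e (f Y) = e (f Z)"
      using Lovasz_Kneser[OF k(1) n, of "\<lambda>Y. e (f Y)"] by blast
    have "f Y = f Z" using same e f[OF YZ(1,3)] f[OF YZ(2,4)] by (metis bij_betw_def inj_onD)
    then obtain u v where "u \<in> convex hull (y ` Y)" "v \<in> convex hull (y ` Z)"
      "norm (f Y - u) < c" "norm (f Y - v) < c"
      using f[OF YZ(1,3)] f[OF YZ(2,4)] by auto
    \<comment> \<open>Two disjoint sets of one colour have hulls within \<open>c\<close> of a common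
      point, against the separation \<open>2 * c\<close>.\<close>
    moreover from this have "2 * c \<le> norm (u - v)" using sep[OF YZ(1,2,5)] by blast
    moreover have "norm (u - v) \<le> norm (f Y - v) + norm (f Y - u)"
      using norm_triangle_ineq4[of "f Y - v" "f Y - u"] by simp
    ultimately show False by linarith
  qed
  have "ennreal (c / 2) \<le> (INF F\<in>{F :: 'a set. finite F \<and> card F \<le> M}.
      SUP Y\<in>{Y. Y \<subseteq> P \<and> \<epsilon> * real (card P) \<le> real (card Y)}.
        eset_dist F (convex hull Y) / ennreal (diameter P))"
  proof (rule INF_greatest)
    fix F :: "'a set" assume "F \<in> {F. finite F \<and> card F \<le> M}"
    then obtain Y where Y: "Y \<subseteq> P" "\<epsilon> * real (card P) \<le> real (card Y)"
      and d: "ennreal c \<le> eset_dist F (convex hull Y)"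
      using far by auto
    have "ennreal (c / 2) \<le> ennreal (c / diameter P)"
      using diam2 diam0 c by (intro ennreal_leI divide_left_mono) auto
    also have "\<dots> = ennreal c / ennreal (diameter P)"
      using c diam0 by (intro divide_ennreal[symmetric]) auto
    also have "\<dots> \<le> eset_dist F (convex hull Y) / ennreal (diameter P)"
      using d by (rule divide_right_mono_ennreal)
    also have "\<dots> \<le> (SUP Y\<in>{Y. Y \<subseteq> P \<and> \<epsilon> * real (card P) \<le> real (card Y)}.
        eset_dist F (convex hull Y) / ennreal (diameter P))"
      using Y by (intro SUP_upper) simp
    finally show "ennreal (c / 2) \<le> \<dots>" .
  qed
  also have "\<dots> \<le> weak_net TYPE('a) \<epsilon> M"
    unfolding weak_net_def using finP diam0 by (intro SUP_upper) simp
  finally show ?thesis .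
qed

theorem theorem7p1:
  assumes "trivial_type TYPE('a::banach)"
  shows "(\<forall>(\<epsilon>::real) (M::nat). 0 < \<epsilon> \<and> \<epsilon> < 1/2 \<longrightarrow> weak_net TYPE('a) \<epsilon> M \<ge> ennreal (1/2)) \<and>
         (\<forall>(\<epsilon>::real) (\<eta>::real). 0 < \<epsilon> \<and> \<epsilon> < 1/2 \<and> 0 < \<eta> \<and> \<eta> < 1/2 \<longrightarrow>
            \<not> (\<exists>M::nat. weak_net TYPE('a) \<epsilon> M \<le> ennreal \<eta>))"
proof -
  have less: "ennreal \<eta> < weak_net TYPE('a) \<epsilon> M"
    if \<epsilon>: "0 < \<epsilon>" "\<epsilon> < 1/2" and \<eta>: "0 < \<eta>" "\<eta> < 1/2" for \<epsilon> \<eta> :: real and M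
  proof -
    \<comment> \<open>Since \<open>\<eta> < 1/2\<close>, this gives both \<open>c < 1\<close> and
      \<open>\<eta> < c / 2\<close>.\<close>
    define c where "c = \<eta> + 1/2"
    have c: "0 < c" "c < 1" "\<eta> < c / 2" unfolding c_def using \<eta> by auto
    \<comment> \<open>As \<open>k < \<epsilon> * n + 1\<close>, the condition
      \<open>M + 2 * k \<le> n + 1\<close> follows from
      \<open>(1 - 2 * \<epsilon>) * n \<ge> M + 1\<close>.\<close>
    obtain n0 :: nat where n0: "(real M + 1) / (1 - 2 * \<epsilon>) \<le> real n0" using real_arch_simple by blast
    define n where "n = n0 + 2"
    define k where "k = nat \<lceil>\<epsilon> * real n\<rceil>"
    have n2: "2 \<le> n" unfolding n_def by simp
    have "0 < \<epsilon> * real n" using \<epsilon> n2 by simp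
    then have k: "0 < k" "\<epsilon> * real n \<le> real k" "real k < \<epsilon> * real n + 1"
      unfolding k_def by linarith+
    have "(real M + 1) / (1 - 2 * \<epsilon>) \<le> real n" using n0 unfolding n_def by simp
    then have "real M + 1 \<le> (1 - 2 * \<epsilon>) * real n" using \<epsilon> by (simp add: field_simps)
    then have "real M + 2 * real k < real n + 1" using k(3) by (simp add: algebra_simps)
    then have "M + 2 * k \<le> n + 1" by linarith
    moreover obtain y :: "nat \<Rightarrow> 'a" where "\<And>i. i < n \<Longrightarrow> norm (y i) \<le> 1"
      "\<And>a. c * (\<Sum>i<n. \<bar>a i\<bar>) \<le> norm (\<Sum>i<n. a i *\<^sub>R y i)"
      using not_rad_bound_imp_almost_isometric_l1[OF trivial_type_imp_not_rad_bound[OF assms n2] n2 c(1,2)]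
      by blast
    ultimately have "ennreal (c / 2) \<le> weak_net TYPE('a) \<epsilon> M"
      using k c n2 by (intro weak_net_ge_of_l1[of k \<epsilon> n M c y]) auto
    moreover have "ennreal \<eta> < ennreal (c / 2)" using c \<eta> by (intro ennreal_lessI) auto
    ultimately show ?thesis by (rule less_le_trans[rotated])
  qed
  show ?thesis
  proof (intro conjI allI impI)
    fix \<epsilon> :: real and M :: nat assume \<epsilon>: "0 < \<epsilon> \<and> \<epsilon> < 1/2"
    show "ennreal (1/2) \<le> weak_net TYPE('a) \<epsilon> M"
    proof (rule ccontr)
      assume "\<not> ?thesis"
      then have lt: "weak_net TYPE('a) \<epsilon> M < ennreal (1/2)" by simp
      then obtain w where w: "weak_net TYPE('a) \<epsilon> M = ennreal w" "0 \<le> w"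
        by (cases "weak_net TYPE('a) \<epsilon> M") auto
      then have "w < 1/2" using lt ennreal_less_iff[OF w(2), of "1/2"] by metis
      \<comment> \<open>The midpoint of \<open>w\<close> and 1/2 serves as \<open>\<eta>\<close> in
        the strict bound.\<close>
      then have "ennreal ((w + 1/2) / 2) < ennreal w"
        using less[of \<epsilon> "(w + 1/2) / 2" M] \<epsilon> w by simp
      then show False using \<open>w < 1/2\<close> w(2) by (simp add: ennreal_less_iff)
    qed
  next
    fix \<epsilon> \<eta> :: real assume "0 < \<epsilon> \<and> \<epsilon> < 1/2 \<and> 0 < \<eta> \<and> \<eta> < 1/2"
    then show "\<not> (\<exists>M. weak_net TYPE('a) \<epsilon> M \<le> ennreal \<eta>)"
      using less[of \<epsilon> \<eta>] by (auto simp: not_le)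
  qed
qed

end
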